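(* Let $K$ be a field of characteristic $0$, let $n\ge1$, and let $r$ be an integer not equal to any of $0,1,\dots,n-2$ nor to $-\binom{n-1}{2}$. For $1\le j\le n$ let $$u_j^{(r)}=(-1)^{j-1}z_j^{r}\,\Delta(z_1,\dots,\widehat{z_j},\dots,z_n),\qquad \Delta(y_1,\dots,y_k)=\prod_{1\le a<b\le k}(y_a-y_b),$$ where $\widehat{z_j}$ means that $z_j$ is omitted. Then for every series $\Phi(z_1,\dots,z_n)\in K^{\rho}\langle\!\langle z_1,\dots,z_n\rangle\!\rangle$, where $\rho$ sends $z_i$ to the initial term of $u_i^{(r)}$, $$\mathop{\mathrm{CT}}_{z_1,\dots,z_n}\Phi(u_1^{(r)},\dots,u_n^{(r)})=\mathop{\mathrm{CT}}_{u_1^{(r)},\dots,u_n^{(r)}}\Phi(u_1^{(r)},\dots,u_n^{(r)}),$$ where the left-hand constant term is taken in $K\langle\!\langle z_1,\dots,z_n\rangle\!\rangle$ and the right-hand side means the constant term (coefficient of $z_1^0\cdots z_n^0$) of $\Phi(z_1,\dots,z_n)$.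
   Context: $K\langle\!\langle z_1,\dots,z_n\rangle\!\rangle$ is the field of iterated Laurent series $K((z_1))((z_2))\cdots((z_n))$; equivalently, the formal series $\sum_{\mathbf k\in\mathbb{Z}^n}c_{\mathbf k}\mathbf z^{\mathbf k}$ ($c_{\mathbf k}\in K$) whose support $\{\mathbf k:c_{\mathbf k}\ne0\}$ is well-ordered in the reverse lexicographic ordering of $\mathbb{Z}^n$ ($\mathbf k<\mathbf l$ iff for some $i$, $k_i<l_i$ and $k_j=l_j$ for all $j>i$). The initial term of a nonzero series is the term whose exponent is the minimum of its support (e.g. the initial term of $z_i-z_j$ is $z_i$ if $i<j$). If the initial term of $u_i^{(r)}$ is $\pm\mathbf z^{\mathbf b_i}$, $\rho$ also denotes the endomorphism of $\mathbb{Z}^n$ sending the $i$-th standard basis vector to $\mathbf b_i$ (injective under the stated hypothesis on $r$). $K^{\rho}\langle\!\langle z_1,\dots,z_n\rangle\!\rangle$ is the field of formal series $\sum_{\mathbf k}c_{\mathbf k}\mathbf z^{\mathbf k}$ whose support is well-ordered for the ordering $\mathbf k\le^\rho\mathbf l\iff\rho(\mathbf k)\le\rho(\mathbf l)$ (reverse lexicographic ordering on the right). For $\Phi=\sum c_{\mathbf k}\mathbf z^{\mathbf k}$ in this field, $\Phi(u_1^{(r)},\dots,u_n^{(r)})=\sum c_{\mathbf k}\prod_i(u_i^{(r)})^{k_i}$ converges in $K\langle\!\langle z_1,\dots,z_n\rangle\!\rangle$ (each monomial receives only finitely many nonzero contributions). *)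

theory Defs
  imports Complex_Main "HOL-Algebra.Ring"
begin

text \<open>
  A formal series over \<open>K\<close> in \<open>z\<^sub>1, \<dots>, z\<^sub>n\<close> is its coefficient function. The number of
  variables \<open>n\<close> varies, so an exponent vector in \<open>\<int>\<^sup>n\<close> is a function \<open>nat \<Rightarrow> int\<close> that
  vanishes outside \<open>{1..n}\<close>.
\<close>

type_synonym expo = "nat \<Rightarrow> int"
type_synonym 'a fseries = "expo \<Rightarrow> 'a"

definition expos :: "nat \<Rightarrow> expo set" where
  "expos n = {k. \<forall>i. i \<notin> {1..n} \<longrightarrow> k i = 0}"

definition revlex_less :: "expo \<Rightarrow> expo \<Rightarrow> bool" where
  "revlex_less k l \<longleftrightarrow> (\<exists>i. k i < l i \<and> (\<forall>j>i. k j = l j))"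

definition revlex_le :: "expo \<Rightarrow> expo \<Rightarrow> bool" where
  "revlex_le k l \<longleftrightarrow> k = l \<or> revlex_less k l"

definition supp :: "'a::zero fseries \<Rightarrow> expo set" where
  "supp f = {k. f k \<noteq> 0}"

text \<open>
  The underlying set of \<open>K\<^sup>\<rho>\<langle>\<langle>z\<^sub>1, \<dots>, z\<^sub>n\<rangle>\<rangle>\<close>; \<open>\<rho> = id\<close> gives \<open>K\<langle>\<langle>z\<^sub>1, \<dots>, z\<^sub>n\<rangle>\<rangle>\<close>.
\<close>

definition series_set :: "nat \<Rightarrow> (expo \<Rightarrow> expo) \<Rightarrow> 'a::zero fseries set" where
  "series_set n \<rho> = {f. supp f \<subseteq> expos n \<and>
     well_order_on (supp f) {(k, l). k \<in> supp f \<and> l \<in> supp f \<and> revlex_le (\<rho> k) (\<rho> l)}}"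

text \<open>
  The field \<open>K\<langle>\<langle>z\<^sub>1, \<dots>, z\<^sub>n\<rangle>\<rangle>\<close>. The index set of the convolution sum is finite for factors
  in the carrier.
\<close>

definition ils :: "nat \<Rightarrow> 'a::field fseries ring" where
  "ils n = \<lparr>carrier = series_set n id,
     mult = (\<lambda>f g m. \<Sum>k | f k \<noteq> 0 \<and> g (\<lambda>i. m i - k i) \<noteq> 0. f k * g (\<lambda>i. m i - k i)),
     one = (\<lambda>k. if k = (\<lambda>_. 0) then 1 else 0),
     zero = (\<lambda>_. 0),
     add = (\<lambda>f g k. f k + g k)\<rparr>"

definition zvar :: "nat \<Rightarrow> 'a::field fseries" where
  "zvar i = (\<lambda>k. if k = (\<lambda>j. if j = i then 1 else 0) then 1 else 0)"

definition const_term :: "'a fseries \<Rightarrow> 'a" where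
  "const_term f = f (\<lambda>_. 0)"

definition initial_exp :: "'a::zero fseries \<Rightarrow> expo" where
  "initial_exp f = (THE k. k \<in> supp f \<and> (\<forall>l \<in> supp f. revlex_le k l))"

definition Delta :: "('b, 'm) ring_scheme \<Rightarrow> (nat \<Rightarrow> 'b) \<Rightarrow> nat set \<Rightarrow> 'b" where
  "Delta R y I = finprod R (\<lambda>(a, b). y a \<ominus>\<^bsub>R\<^esub> y b) {(a, b). a \<in> I \<and> b \<in> I \<and> a < b}"

definition useries :: "nat \<Rightarrow> int \<Rightarrow> nat \<Rightarrow> 'a::field fseries" where
  "useries n r j =
     (\<ominus>\<^bsub>ils n\<^esub> \<one>\<^bsub>ils n\<^esub>) [^]\<^bsub>ils n\<^esub> (j - 1) \<otimes>\<^bsub>ils n\<^esub> zvar j [^]\<^bsub>ils n\<^esub> r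
       \<otimes>\<^bsub>ils n\<^esub> Delta (ils n) zvar ({1..n} - {j})"

text \<open>The endomorphism of \<open>\<int>\<^sup>n\<close> that sends \<open>e\<^sub>i\<close> to the initial exponent of \<open>u i\<close>.\<close>

definition rho :: "nat \<Rightarrow> (nat \<Rightarrow> 'a::zero fseries) \<Rightarrow> expo \<Rightarrow> expo" where
  "rho n u k = (\<lambda>j. \<Sum>i = 1..n. k i * initial_exp (u i) j)"

definition monomial_at :: "nat \<Rightarrow> (nat \<Rightarrow> 'a::field fseries) \<Rightarrow> expo \<Rightarrow> 'a fseries" where
  "monomial_at n u k = finprod (ils n) (\<lambda>i. u i [^]\<^bsub>ils n\<^esub> k i) {1..n}"

text \<open>
  The value \<open>\<Phi>(u\<^sub>1, \<dots>, u\<^sub>n)\<close> is computed coefficientwise. It is meaningful only under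
  \<open>eval_converges\<close>, since a sum over an infinite index set is \<open>0\<close> by convention.
\<close>

definition contributions ::
    "nat \<Rightarrow> 'a::field fseries \<Rightarrow> (nat \<Rightarrow> 'a fseries) \<Rightarrow> expo \<Rightarrow> expo set" where
  "contributions n \<Phi> u m = {k. \<Phi> k * monomial_at n u k m \<noteq> 0}"

definition eval_series :: "nat \<Rightarrow> 'a::field fseries \<Rightarrow> (nat \<Rightarrow> 'a fseries) \<Rightarrow> 'a fseries" where
  "eval_series n \<Phi> u = (\<lambda>m. \<Sum>k \<in> contributions n \<Phi> u m. \<Phi> k * monomial_at n u k m)"

definition eval_converges ::
    "nat \<Rightarrow> 'a::field fseries \<Rightarrow> (nat \<Rightarrow> 'a fseries) \<Rightarrow> bool" where
  "eval_converges n \<Phi> u \<longleftrightarrow>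
     (\<forall>m. finite (contributions n \<Phi> u m)) \<and> eval_series n \<Phi> u \<in> carrier (ils n)"

end

theory Submission
  imports Defs "Jordan_Normal_Form.Determinant"
begin

text \<open>
  This is Jacobi's residue argument. Write \<open>D\<^sub>i = z\<^sub>i \<partial>/\<partial>z\<^sub>i\<close>; constant terms of series \<open>D\<^sub>i f\<close> vanish.
  If the logarithmic Jacobian determinant \<open>det (D\<^sub>i log u\<^sub>l)\<close> is a nonzero constant, then the vector
  fields dual to \<open>d log u\<^sub>l\<close> are divergence free, so that \<open>k\<^sub>j u\<^sup>k\<close> is a sum of series \<open>D\<^sub>i f\<^sub>i\<close> and
  \<open>u\<^sup>k\<close> has constant term \<open>0\<close> for \<open>k \<noteq> 0\<close>. The transposed logarithmic Jacobian is triangular in the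
  basis of the vectors \<open>(z\<^sub>l\<^sup>t\<^sup>-\<^sup>1)\<^sub>l\<close>, \<open>0 \<le> t < n\<close>, with diagonal entries \<open>r\<close>, \<open>r + binomial(n - 1, 2)\<close> and
  \<open>r + t - n\<close> for \<open>2 \<le> t < n\<close>; these are nonzero exactly under the hypotheses on \<open>r\<close>.
  For convergence, \<open>u\<^sup>k\<close> is supported in the translate by \<open>\<rho>(k)\<close> of the well-ordered cone generated
  by the exponents of \<open>z\<^sub>b / z\<^sub>a\<close>, \<open>a < b\<close>.
\<close>

section \<open>Well-ordered subsets of ordered groups\<close>

text \<open>Determinants and derivations need an ambient commutative ring, while
  \<open>ils n\<close> is a record whose carrier varies with \<open>n\<close>. The argument
  therefore runs in a type of Hahn series and is transferred to \<open>ils n\<close> afterwards.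
  That type is only shown to be a commutative ring: every division, by z_i, z_i - z_b, u_j, 2 or the
  determinant, is by an element with an explicit inverse. Inverses are tracked together with their
  leading exponents, so that u^k is controlled for negative entries of k too. The basis z_l^(t-1) is
  suggested by the entries z_i / (z_i - z_b): after multiplication by z_i^(t-1), the two orders of a
  pair combine into (z_i^t - z_b^t) / (z_i - z_b), a polynomial of degree t - 1. The diagonal is
  constant because only degree 0 survives there; the binomial coefficient counts the pairs at t = 1.
  Characteristic 0 makes 2 and the integer determinant invertible and keeps a nonzero k_j nonzero in
  K.\<close>

lemma finite_if_wfp_on_both:
  fixes X :: "'b::linorder set"
  assumes "wfp_on X (<)" and "wfp_on X (>)"
  shows "finite X"
proof (rule ccontr)
  assume inf: "infinite X"
  have max: "\<exists>z\<in>B. \<forall>y\<in>B. y \<le> z" if "B \<subseteq> X" "B \<noteq> {}" for B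
    using assms(2) that unfolding wfp_on_iff_ex_minimal by (meson not_less)
  have min: "\<exists>z\<in>B. \<forall>y\<in>B. z \<le> y" if "B \<subseteq> X" "B \<noteq> {}" for B
    using assms(1) that unfolding wfp_on_iff_ex_minimal by (meson not_less)
  \<comment> \<open>The greatest element of \<open>X\<close> below the least element of
    \<open>Y\<close> would again lie in \<open>Y\<close>.\<close>
  define Y where "Y = {x\<in>X. infinite {y\<in>X. y \<le> x}}"
  from max[of X] inf obtain x where x: "x \<in> X" "\<forall>y\<in>X. y \<le> x" by auto
  then have "{y\<in>X. y \<le> x} = X" by auto
  with inf x have "x \<in> Y" by (simp add: Y_def)
  then obtain z where z: "z \<in> Y" "\<forall>y\<in>Y. z \<le> y"
    using min[of Y] by (auto simp: Y_def)
  have "{y\<in>X. y \<le> z} = insert z {y\<in>X. y < z}" using z(1) by (auto simp: Y_def)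
  with z(1) have inf': "infinite {y\<in>X. y < z}" by (auto simp: Y_def)
  then obtain w where w: "w \<in> X" "w < z" "\<forall>y\<in>X. y < z \<longrightarrow> y \<le> w"
    using max[of "{y\<in>X. y < z}"] by (auto dest: infinite_imp_nonempty)
  have "{y\<in>X. y < z} = {y\<in>X. y \<le> w}" using w by auto
  with inf' w have "w \<in> Y" by (simp add: Y_def)
  with z w(2) show False by auto
qed

text \<open>In a set \<open>X\<close> of sums choose a + b with the least possible first summand.
  Every element of \<open>X\<close> below a + b then has a second summand smaller than b, so an
  induction on b finds the minimum.\<close>

lemma wfp_on_less_image_plus:
  fixes A B :: "'g::linordered_ab_group_add set"
  assumes A: "wfp_on A (<)" and B: "wfp_on B (<)"
  shows "wfp_on ((\<lambda>(a, b). a + b) ` (A \<times> B)) (<)"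
proof -
  have minA: "\<exists>z\<in>C. \<forall>y\<in>C. z \<le> y" if "C \<subseteq> A" "C \<noteq> {}" for C
    using A that unfolding wfp_on_iff_ex_minimal by (meson not_less)
  have *: "\<exists>a b. a \<in> A \<and> b \<in> B \<and> a + b \<in> X \<and> (\<forall>a'\<in>A. \<forall>b'\<in>B. a' + b' \<in> X \<longrightarrow> a \<le> a')"
    if "X \<subseteq> (\<lambda>(a, b). a + b) ` (A \<times> B)" "X \<noteq> {}" for X
  proof -
    have "{a\<in>A. \<exists>b\<in>B. a + b \<in> X} \<noteq> {}" using that by auto
    from minA[OF _ this] obtain a where "a \<in> A" "\<exists>b\<in>B. a + b \<in> X"
      "\<forall>a'\<in>{a\<in>A. \<exists>b\<in>B. a + b \<in> X}. a \<le> a'" by auto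
    then show ?thesis by blast
  qed
  have "\<forall>X a. X \<subseteq> (\<lambda>(a, b). a + b) ` (A \<times> B) \<longrightarrow> a \<in> A \<longrightarrow> a + b \<in> X \<longrightarrow>
      (\<forall>a'\<in>A. \<forall>b'\<in>B. a' + b' \<in> X \<longrightarrow> a \<le> a') \<longrightarrow> (\<exists>z\<in>X. \<forall>y\<in>X. z \<le> y)" if "b \<in> B" for b
    using B
  proof (induction rule: wfp_on_induct)
    case in_set
    show ?case by (rule that)
  next
    case (less b)
    show ?case
    proof (intro allI impI)
      fix X a
      assume X: "X \<subseteq> (\<lambda>(a, b). a + b) ` (A \<times> B)" and a: "a \<in> A" "a + b \<in> X"
        and amin: "\<forall>a'\<in>A. \<forall>b'\<in>B. a' + b' \<in> X \<longrightarrow> a \<le> a'"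
      define X' where "X' = {x\<in>X. x < a + b}"
      show "\<exists>z\<in>X. \<forall>y\<in>X. z \<le> y"
      proof (cases "X' = {}")
        case True
        then show ?thesis using a by (intro bexI[of _ "a + b"]) (auto simp: X'_def not_less)
      next
        case False
        have X': "X' \<subseteq> (\<lambda>(a, b). a + b) ` (A \<times> B)" using X by (auto simp: X'_def)
        from *[OF X' False] obtain a1 b1 where 1: "a1 \<in> A" "b1 \<in> B" "a1 + b1 \<in> X'"
          "\<forall>a'\<in>A. \<forall>b'\<in>B. a' + b' \<in> X' \<longrightarrow> a1 \<le> a'" by blast
        have "a \<le> a1" using amin 1 by (auto simp: X'_def)
        moreover have "a1 + b1 < a + b" using 1 by (simp add: X'_def)
        ultimately have "b1 < b"
          by (metis add_mono not_less)
        then obtain z where z: "z \<in> X'" "\<forall>y\<in>X'. z \<le> y"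
          using less.IH[OF 1(2), THEN spec, THEN spec, THEN mp, OF _ X', THEN mp, OF _ 1(1),
              THEN mp, OF _ 1(3), THEN mp, OF _ 1(4)] by auto
        have "z \<le> y" if "y \<in> X" for y
          using z that by (cases "y < a + b") (auto simp: X'_def)
        then show ?thesis using z by (auto simp: X'_def)
      qed
    qed
  qed
  then have "\<exists>z\<in>X. \<forall>y\<in>X. z \<le> y" if "X \<subseteq> (\<lambda>(a, b). a + b) ` (A \<times> B)" "X \<noteq> {}" for X
    using *[OF that] that(1) by blast
  then show ?thesis
    unfolding wfp_on_iff_ex_minimal by (meson not_less)
qed

text \<open>The map a -> m - a reverses the order, so the set is well-ordered in both directions.
  This makes convolution sums finite and later gives convergence.\<close>

lemma finite_sum_representations:
  fixes A B :: "'g::linordered_ab_group_add set"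
  assumes A: "wfp_on A (<)" and B: "wfp_on B (<)"
  shows "finite {a\<in>A. m - a \<in> B}"
proof (rule finite_if_wfp_on_both)
  show "wfp_on {a\<in>A. m - a \<in> B} (<)" by (rule wfp_on_subset[OF A]) auto
  show "wfp_on {a\<in>A. m - a \<in> B} (>)"
  proof (unfold wfp_on_iff_ex_minimal, intro allI impI)
    fix C assume C: "C \<subseteq> {a\<in>A. m - a \<in> B}" "C \<noteq> {}"
    then have "(\<lambda>a. m - a) ` C \<subseteq> B" "(\<lambda>a. m - a) ` C \<noteq> {}" by auto
    then obtain z where "z \<in> (\<lambda>a. m - a) ` C" "\<forall>y. y < z \<longrightarrow> y \<notin> (\<lambda>a. m - a) ` C"
      using B unfolding wfp_on_iff_ex_minimal by meson
    then show "\<exists>z\<in>C. \<forall>y. z < y \<longrightarrow> y \<notin> C"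
      by (auto simp: image_iff) (metis diff_strict_left_mono)
  qed
qed

lemma wfp_on_Un_less:
  fixes A B :: "'g::linorder set"
  assumes "wfp_on A (<)" and "wfp_on B (<)"
  shows "wfp_on (A \<union> B) (<)"
proof (unfold wfp_on_iff_ex_minimal, intro allI impI)
  fix C assume C: "C \<subseteq> A \<union> B" "C \<noteq> {}"
  have ex: "\<exists>z\<in>C \<inter> D. \<forall>y\<in>C \<inter> D. z \<le> y" if "wfp_on D (<)" "C \<inter> D \<noteq> {}" for D :: "'g set"
    using that unfolding wfp_on_iff_ex_minimal by (metis inf.cobounded2 not_less)
  show "\<exists>z\<in>C. \<forall>y. y < z \<longrightarrow> y \<notin> C"
  proof (cases "C \<inter> A = {} \<or> C \<inter> B = {}")
    case True
    with C(1) assms obtain D where "wfp_on D (<)" "C \<subseteq> D" by blast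
    then show ?thesis using C(2) unfolding wfp_on_iff_ex_minimal by blast
  next
    case False
    then obtain a b where "a \<in> C" "b \<in> C" "\<forall>y\<in>C \<inter> A. a \<le> y" "\<forall>y\<in>C \<inter> B. b \<le> y"
      using ex[OF assms(1)] ex[OF assms(2)] by auto
    then have "min a b \<in> C" "\<forall>y\<in>C. min a b \<le> y"
      using C(1) unfolding min_le_iff_disj by (simp add: min_def, blast)
    then show ?thesis by (meson not_less)
  qed
qed

section \<open>Hahn series\<close>

text \<open>One type serves every number of variables; the restriction to n of them becomes the
  subset \<open>hahn_vars n\<close>.\<close>

typedef (overloaded) ('g, 'a) hahn =
  "{f :: 'g::linordered_ab_group_add \<Rightarrow> 'a::zero. wfp_on {k. f k \<noteq> 0} (<)}"
  morphisms hcoeff Abs_hahn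
  by (rule exI[of _ "\<lambda>_. 0"]) (simp add: wfp_on_def)

setup_lifting type_definition_hahn

definition hsupp :: "('g::linordered_ab_group_add, 'a::zero) hahn \<Rightarrow> 'g set" where
  "hsupp f = {k. hcoeff f k \<noteq> 0}"

lemma wfp_on_hsupp: "wfp_on (hsupp f) (<)"
  unfolding hsupp_def using hcoeff by auto

lemma hahn_eqI: "(\<And>k. hcoeff f k = hcoeff g k) \<Longrightarrow> f = g"
  by (simp add: hcoeff_inject[symmetric] fun_eq_iff)

instantiation hahn :: (linordered_ab_group_add, ab_group_add) ab_group_add
begin

lift_definition zero_hahn :: "('a, 'b) hahn" is "\<lambda>_. 0" by (simp add: wfp_on_def)

lift_definition plus_hahn :: "('a, 'b) hahn \<Rightarrow> ('a, 'b) hahn \<Rightarrow> ('a, 'b) hahn"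
  is "\<lambda>f g k. f k + g k"
  by (erule (1) wfp_on_subset[OF wfp_on_Un_less]) auto

lift_definition uminus_hahn :: "('a, 'b) hahn \<Rightarrow> ('a, 'b) hahn" is "\<lambda>f k. - f k" by simp

definition minus_hahn :: "('a, 'b) hahn \<Rightarrow> ('a, 'b) hahn \<Rightarrow> ('a, 'b) hahn" where
  "minus_hahn f g = f + - g"

instance
  by standard (transfer; simp add: fun_eq_iff add.assoc add.commute minus_hahn_def; fail)+

end

lemma hcoeff_0 [simp]: "hcoeff 0 k = 0" by (simp add: zero_hahn.rep_eq)
lemma hcoeff_add [simp]: "hcoeff (f + g) k = hcoeff f k + hcoeff g k" by (simp add: plus_hahn.rep_eq)
lemma hcoeff_uminus [simp]: "hcoeff (- f) k = - hcoeff f k" by (simp add: uminus_hahn.rep_eq)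
lemma hcoeff_diff [simp]: "hcoeff (f - g) k = hcoeff f k - hcoeff g k"
  by (simp only: minus_hahn_def hcoeff_add hcoeff_uminus diff_conv_add_uminus)
lemma hcoeff_sum [simp]: "hcoeff (sum F A) k = (\<Sum>a\<in>A. hcoeff (F a) k)"
  by (induction A rule: infinite_finite_induct) auto

lemma finite_hsupp_pairs: "finite {k\<in>hsupp f. m - k \<in> hsupp g}"
  by (rule finite_sum_representations[OF wfp_on_hsupp wfp_on_hsupp])

lift_definition single :: "'g::linordered_ab_group_add \<Rightarrow> 'a::zero \<Rightarrow> ('g, 'a) hahn"
  is "\<lambda>e c k. if k = e then c else 0"
  by (auto simp: wfp_on_def)

lemma hcoeff_single: "hcoeff (single e c) k = (if k = e then c else 0)"
  by (simp add: single.rep_eq)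

section \<open>The convolution product\<close>

instantiation hahn :: (linordered_ab_group_add, comm_ring_1) comm_ring_1
begin

lift_definition times_hahn :: "('a, 'b) hahn \<Rightarrow> ('a, 'b) hahn \<Rightarrow> ('a, 'b) hahn"
  is "\<lambda>f g m. \<Sum>k | f k \<noteq> 0 \<and> g (m - k) \<noteq> 0. f k * g (m - k)"
proof -
  fix f g :: "'a \<Rightarrow> 'b"
  assume "wfp_on {k. f k \<noteq> 0} (<)" "wfp_on {k. g k \<noteq> 0} (<)"
  note * = wfp_on_less_image_plus[OF this]
  show "wfp_on {m. (\<Sum>k | f k \<noteq> 0 \<and> g (m - k) \<noteq> 0. f k * g (m - k)) \<noteq> 0} (<)"
  proof (rule wfp_on_subset[OF *], rule subsetI, clarify)
    fix m assume "(\<Sum>k | f k \<noteq> 0 \<and> g (m - k) \<noteq> 0. f k * g (m - k)) \<noteq> 0"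
    then obtain k where "f k \<noteq> 0 \<and> g (m - k) \<noteq> 0"
      by (auto elim: sum.not_neutral_contains_not_neutral)
    then show "m \<in> (\<lambda>(a, b). a + b) ` ({k. f k \<noteq> 0} \<times> {k. g k \<noteq> 0})"
      by (auto intro!: image_eqI[of _ _ "(k, m - k)"])
  qed
qed

definition one_hahn :: "('a, 'b) hahn" where "one_hahn = single 0 1"

text \<open>Convolutions of series with different supports can be compared term by term once they
  are summed over a common finite index set.\<close>

lemma hcoeff_mult_superset:
  assumes "finite K" "\<And>k. k \<in> hsupp f \<Longrightarrow> m - k \<in> hsupp g \<Longrightarrow> k \<in> K"
  shows "hcoeff (f * g) m = (\<Sum>k\<in>K. hcoeff f k * hcoeff g (m - k))"
  unfolding times_hahn.rep_eq
  by (rule sum.mono_neutral_left) (use assms in \<open>auto simp: hsupp_def\<close>)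

lemma hcoeff_mult:
  "hcoeff (f * g) m = (\<Sum>k\<in>{k\<in>hsupp f. m - k \<in> hsupp g}. hcoeff f k * hcoeff g (m - k))"
  by (rule hcoeff_mult_superset) (simp_all add: finite_hsupp_pairs)

lemma hsupp_mult: "hsupp (f * g) \<subseteq> (\<lambda>(a, b). a + b) ` (hsupp f \<times> hsupp g)"
proof
  fix m assume "m \<in> hsupp (f * g)"
  then have "hcoeff (f * g) m \<noteq> 0" by (simp add: hsupp_def)
  then obtain k where "k \<in> hsupp f" "m - k \<in> hsupp g"
    unfolding hcoeff_mult
    by (auto elim: sum.not_neutral_contains_not_neutral)
  then show "m \<in> (\<lambda>(a, b). a + b) ` (hsupp f \<times> hsupp g)"
    by (auto intro!: image_eqI[of _ _ "(k, m - k)"])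
qed

lemma hsupp_single: "hsupp (single e c) \<subseteq> {e}"
  by (auto simp: hsupp_def hcoeff_single)

lemma hcoeff_single_mult: "hcoeff (single e c * f) m = c * hcoeff f (m - e)"
proof -
  have "hcoeff (single e c * f) m = (\<Sum>k\<in>{e}. hcoeff (single e c) k * hcoeff f (m - k))"
    by (rule hcoeff_mult_superset) (use hsupp_single in auto)
  then show ?thesis by (simp add: hcoeff_single)
qed

instance
proof
  fix f g h :: "('a, 'b) hahn"
  show comm: "f * g = g * f" for f g :: "('a, 'b) hahn"
  proof (rule hahn_eqI)
    fix m
    show "hcoeff (f * g) m = hcoeff (g * f) m"
      unfolding hcoeff_mult
      by (rule sum.reindex_bij_witness[of _ "\<lambda>k. m - k" "\<lambda>k. m - k"]) (auto simp: mult.commute)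
  qed
  show "1 * f = f"
    by (rule hahn_eqI) (simp add: one_hahn_def hcoeff_single_mult)
  show "(0 :: ('a, 'b) hahn) \<noteq> 1"
    by (metis hcoeff_0 hcoeff_single one_hahn_def zero_neq_one)
  show "(f + g) * h = f * h + g * h"
  proof (rule hahn_eqI)
    fix m
    let ?K = "{k\<in>hsupp f \<union> hsupp g. m - k \<in> hsupp h}"
    have K: "finite ?K"
      by (rule finite_sum_representations) (intro wfp_on_Un_less wfp_on_hsupp)+
    have "hcoeff ((f + g) * h) m = (\<Sum>k\<in>?K. hcoeff (f + g) k * hcoeff h (m - k))"
      by (rule hcoeff_mult_superset[OF K]) (auto simp: hsupp_def)
    moreover have "hcoeff (f * h) m = (\<Sum>k\<in>?K. hcoeff f k * hcoeff h (m - k))"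
      by (rule hcoeff_mult_superset[OF K]) auto
    moreover have "hcoeff (g * h) m = (\<Sum>k\<in>?K. hcoeff g k * hcoeff h (m - k))"
      by (rule hcoeff_mult_superset[OF K]) auto
    ultimately show "hcoeff ((f + g) * h) m = hcoeff (f * h + g * h) m"
      by (simp add: distrib_right sum.distrib)
  qed
  show "f * g * h = f * (g * h)"
  proof (rule hahn_eqI)
    fix m
    let ?F = "hsupp f" and ?G = "hsupp g" and ?H = "hsupp h"
    \<comment> \<open>The intermediate exponents run through all sums, not through
      \<open>hsupp (f * g)\<close>, from which cancellation may remove some; this makes the two
      double sums correspond bijectively.\<close>
    let ?FG = "(\<lambda>(a, b). a + b) ` (?F \<times> ?G)" and ?GH = "(\<lambda>(a, b). a + b) ` (?G \<times> ?H)"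
    let ?S = "{s\<in>?FG. m - s \<in> ?H}" and ?A = "{a\<in>?F. m - a \<in> ?GH}"
    have S: "finite ?S" and A: "finite ?A"
      by (intro finite_sum_representations wfp_on_less_image_plus wfp_on_hsupp)+
    have "hcoeff (f * g * h) m = (\<Sum>s\<in>?S. hcoeff (f * g) s * hcoeff h (m - s))"
      by (rule hcoeff_mult_superset[OF S]) (use hsupp_mult[of f g] in auto)
    also have "\<dots> = (\<Sum>(s, a)\<in>Sigma ?S (\<lambda>s. {a\<in>?F. s - a \<in> ?G}).
                      hcoeff f a * hcoeff g (s - a) * hcoeff h (m - s))"
      unfolding hcoeff_mult sum_distrib_right
      by (rule sum.Sigma) (auto simp: S finite_hsupp_pairs)
    also have "\<dots> = (\<Sum>(a, b)\<in>Sigma ?A (\<lambda>a. {b\<in>?G. m - a - b \<in> ?H}).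
                      hcoeff f a * (hcoeff g b * hcoeff h (m - a - b)))"
    proof (rule sum.reindex_bij_witness[of _ "\<lambda>(a, b). (a + b, a)" "\<lambda>(s, a). (a, s - a)"])
      have mem: "m \<in> (\<lambda>(a, b). a + b) ` (X \<times> Y)" if "x \<in> X" "m - x \<in> Y" for m x :: 'a and X Y
        using that by (auto intro!: image_eqI[of _ _ "(x, m - x)"])
      fix sa assume sa: "sa \<in> Sigma ?S (\<lambda>s. {a\<in>?F. s - a \<in> ?G})"
      then have "m - snd sa \<in> ?GH"
        by (intro mem[of "fst sa - snd sa"]) auto
      with sa show "(case sa of (s, a) \<Rightarrow> (a, s - a)) \<in> Sigma ?A (\<lambda>a. {b\<in>?G. m - a - b \<in> ?H})"
        by (auto simp: algebra_simps)
    next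
      fix ab assume "ab \<in> Sigma ?A (\<lambda>a. {b\<in>?G. m - a - b \<in> ?H})"
      then show "(case ab of (a, b) \<Rightarrow> (a + b, a)) \<in> Sigma ?S (\<lambda>s. {a\<in>?F. s - a \<in> ?G})"
        by (auto simp: diff_diff_eq)
    qed (auto simp: mult.assoc)
    also have "\<dots> = (\<Sum>a\<in>?A. hcoeff f a * hcoeff (g * h) (m - a))"
      unfolding hcoeff_mult sum_distrib_left
      by (rule sum.Sigma[symmetric]) (auto simp: A finite_hsupp_pairs)
    also have "\<dots> = hcoeff (f * (g * h)) m"
      by (rule hcoeff_mult_superset[OF A, symmetric]) (use hsupp_mult[of g h] in auto)
    finally show "hcoeff (f * g * h) m = hcoeff (f * (g * h)) m" .
  qed
qed

end

lemma hcoeff_1: "hcoeff 1 k = (if k = 0 then 1 else 0)"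
  by (simp add: one_hahn_def hcoeff_single)

lemma single_mult_single: "single a b * single c d = single (a + c) (b * d :: 'a::comm_ring_1)"
  by (rule hahn_eqI) (auto simp: hcoeff_single_mult hcoeff_single algebra_simps)

lemma single_0_1: "single 0 1 = 1"
  by (simp add: one_hahn_def)

lemma single_0_of_int: "single 0 (of_int c) = of_int c"
proof (induction c rule: int_induct[of _ 0])
  case base
  then show ?case by (intro hahn_eqI) (simp add: hcoeff_single)
next
  case (step1 c)
  then show ?case by (intro hahn_eqI) (auto simp: hcoeff_single hcoeff_1 simp flip: step1(2))
next
  case (step2 c)
  then show ?case by (intro hahn_eqI) (auto simp: hcoeff_single hcoeff_1 simp flip: step2(2))
qed

lemma hcoeff_of_int_mult: "hcoeff (of_int c * f) m = of_int c * hcoeff f m"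
  unfolding single_0_of_int[symmetric] by (simp add: hcoeff_single_mult)

section \<open>Derivations and Jacobian matrices\<close>

locale derivation =
  fixes d :: "'r::comm_ring_1 \<Rightarrow> 'r"
  assumes add: "d (x + y) = d x + d y"
    and mult: "d (x * y) = d x * y + x * d y"
begin

lemma zero [simp]: "d 0 = 0"
  using add[of 0 0] by simp

lemma one [simp]: "d 1 = 0"
  using mult[of 1 1] by simp

lemma uminus: "d (- x) = - d x"
  using add[of x "- x"] by (simp add: eq_neg_iff_add_eq_0 add.commute)

lemma diff: "d (x - y) = d x - d y"
  using add[of x "- y"] by (simp add: uminus)

lemma sum: "d (sum f A) = (\<Sum>a\<in>A. d (f a))"
  by (induction A rule: infinite_finite_induct) (auto simp: add)

lemma of_nat [simp]: "d (of_nat n) = 0"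
  by (induction n) (auto simp: add)

lemma of_int [simp]: "d (of_int k) = 0"
  by (cases k rule: int_diff_cases) (simp add: diff)

lemma prod:
  "finite A \<Longrightarrow> d (prod f A) = (\<Sum>a\<in>A. d (f a) * prod f (A - {a}))"
proof (induction A rule: finite_induct)
  case (insert x A)
  have "d (prod f (insert x A)) = d (f x) * prod f A + f x * (\<Sum>a\<in>A. d (f a) * prod f (A - {a}))"
    using insert by (simp add: mult)
  also have "f x * (\<Sum>a\<in>A. d (f a) * prod f (A - {a})) =
      (\<Sum>a\<in>A. d (f a) * prod f (insert x A - {a}))"
    unfolding sum_distrib_left
  proof (rule sum.cong[OF refl])
    fix a assume a: "a \<in> A"
    then have "insert x A - {a} = insert x (A - {a})" using insert by auto
    then show "f x * (d (f a) * prod f (A - {a})) = d (f a) * prod f (insert x A - {a})"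
      using insert by (simp add: algebra_simps)
  qed
  finally show ?case using insert by simp
qed simp

lemma inverse:
  assumes "x * y = 1"
  shows "d y = - (d x * y * y)"
proof -
  have "x * d y = - (d x * y)"
    using mult[of x y] by (simp add: assms eq_neg_iff_add_eq_0 add.commute)
  moreover have "d y = (x * d y) * y"
    using assms by (metis mult.assoc mult.commute mult_1)
  ultimately show ?thesis by simp
qed

text \<open>Jacobi's formula: the product rule differentiates one row at a time, and expansion along
  that row involves only cofactors of \<open>A\<close>.\<close>

lemma det:
  assumes A: "A \<in> carrier_mat n n"
  shows "d (det A) = (\<Sum>i<n. \<Sum>j<n. d (A $$ (i, j)) * cofactor A i j)"
proof -
  define R where "R i = mat n n (\<lambda>(a, b). if a = i then d (A $$ (a, b)) else A $$ (a, b))" for i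
  have R: "R i \<in> carrier_mat n n" for i by (simp add: R_def)
  have "d (det A) = (\<Sum>p | p permutes {0..<n}. of_int (sign p) *
      (\<Sum>i<n. d (A $$ (i, p i)) * (\<Prod>a\<in>{0..<n} - {i}. A $$ (a, p a))))"
    unfolding det_def'[OF A] by (simp add: sum mult prod atLeast0LessThan)
  also have "\<dots> = (\<Sum>i<n. \<Sum>p | p permutes {0..<n}. of_int (sign p) *
      (d (A $$ (i, p i)) * (\<Prod>a\<in>{0..<n} - {i}. A $$ (a, p a))))"
    unfolding sum_distrib_left by (rule sum.swap)
  also have "\<dots> = (\<Sum>i<n. det (R i))"
    unfolding det_def'[OF R]
  proof (intro sum.cong refl, goal_cases)
    case (1 i p)
    then have p: "p a < n" if "a < n" for a
      using permutes_in_image[of p "{0..<n}" a] that by simp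
    have "(\<Prod>a = 0..<n. R i $$ (a, p a)) =
        R i $$ (i, p i) * (\<Prod>a\<in>{0..<n} - {i}. R i $$ (a, p a))"
      using 1 by (intro prod.remove) auto
    also have "(\<Prod>a\<in>{0..<n} - {i}. R i $$ (a, p a)) = (\<Prod>a\<in>{0..<n} - {i}. A $$ (a, p a))"
      by (rule prod.cong) (auto simp: R_def p)
    finally show ?case using 1 p by (simp add: R_def)
  qed
  also have "\<dots> = (\<Sum>i<n. \<Sum>j<n. d (A $$ (i, j)) * cofactor A i j)"
  proof (rule sum.cong[OF refl])
    fix i assume i: "i \<in> {..<n}"
    have "mat_delete (R i) i j = mat_delete A i j" for j
      using A by (auto simp: mat_delete_def R_def)
    then show "det (R i) = (\<Sum>j<n. d (A $$ (i, j)) * cofactor A i j)"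
      using i by (subst laplace_expansion_row[OF R, of i])
        (auto simp: cofactor_def R_def intro!: sum.cong)
  qed
  finally show ?thesis .
qed

end

text \<open>
  With \<open>M i l = D i (log (u l))\<close>, the rows of \<open>B\<close> are the vector fields dual to the forms
  \<open>d log (u l)\<close>.
\<close>

lemma inverse_jacobian_divergence_free:
  fixes D :: "nat \<Rightarrow> 'r::comm_ring_1 \<Rightarrow> 'r" and M :: "nat \<Rightarrow> nat \<Rightarrow> 'r"
  assumes D: "\<And>i. derivation (D i)"
    and closed: "\<And>i j l. i < n \<Longrightarrow> j < n \<Longrightarrow> l < n \<Longrightarrow> D i (M j l) = D j (M i l)"
    and const: "\<And>i. D i (det (mat n n (\<lambda>(i, l). M i l))) = 0"
    and unit: "det (mat n n (\<lambda>(i, l). M i l)) * c = 1"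
  obtains B where "\<And>j l. j < n \<Longrightarrow> l < n \<Longrightarrow> (\<Sum>i<n. B j i * M i l) = of_bool (j = l)"
    and "\<And>j. j < n \<Longrightarrow> (\<Sum>i<n. D i (B j i)) = 0"
proof -
  define A where "A = mat n n (\<lambda>(i, l). M i l)"
  have A: "A \<in> carrier_mat n n" by (simp add: A_def)
  \<comment> \<open>\<open>c\<close> inverts the determinant, so this is the inverse matrix, written
    with the adjugate.\<close>
  define B where "B j i = c * cofactor A i j" for j i
  have BM: "(\<Sum>i<n. B j i * M i l) = of_bool (j = l)" if "j < n" "l < n" for j l
  proof -
    have "(\<Sum>i<n. B j i * M i l) = c * (adj_mat A * A) $$ (j, l)"
      using that A
      by (auto simp: adj_mat_def scalar_prod_def B_def A_def sum_distrib_left mult.assoc atLeast0LessThan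
            intro!: sum.cong)
    also have "\<dots> = of_bool (j = l)"
      unfolding adj_mat(3)[OF A] using that unit by (auto simp: A_def mult.commute)
    finally show ?thesis .
  qed
  have MB: "(\<Sum>m<n. M b m * B m i) = of_bool (b = i)" if "b < n" "i < n" for b i
  proof -
    have "(\<Sum>m<n. M b m * B m i) = c * (A * adj_mat A) $$ (b, i)"
      using that A
      by (auto simp: adj_mat_def scalar_prod_def B_def A_def sum_distrib_left mult_ac atLeast0LessThan
            intro!: sum.cong)
    also have "\<dots> = of_bool (b = i)"
      unfolding adj_mat(2)[OF A] using that unit by (auto simp: A_def mult.commute)
    finally show ?thesis .
  qed
  have "(\<Sum>i<n. D i (B j i)) = 0" if j: "j < n" for j
  proof -
    \<comment> \<open>Differentiating B M = 1 gives D(B) = - B D(M) B. Then \<open>closed\<close>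
      replaces D_i M_bm by D_b M_im, so that summation over i leaves the trace of D_b(M) B.\<close>
    have DB: "D i (B j i) = - (\<Sum>b<n. B j b * (\<Sum>m<n. D b (M i m) * B m i))" if i: "i < n" for i
    proof -
      interpret derivation "D i" by (rule D)
      have *: "(\<Sum>b<n. D i (B j b) * M b m) = - (\<Sum>b<n. B j b * D i (M b m))" if "m < n" for m
      proof -
        have "0 = D i (\<Sum>b<n. B j b * M b m)"
          unfolding BM[OF j that] by simp
        then show ?thesis by (simp add: sum mult sum.distrib eq_neg_iff_add_eq_0)
      qed
      have "D i (B j i) = (\<Sum>b<n. D i (B j b) * of_bool (b = i))"
        using i by simp
      also have "\<dots> = (\<Sum>b<n. D i (B j b) * (\<Sum>m<n. M b m * B m i))"
        by (intro sum.cong refl) (simp add: MB i)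
      also have "\<dots> = (\<Sum>m<n. (\<Sum>b<n. D i (B j b) * M b m) * B m i)"
        unfolding sum_distrib_left sum_distrib_right by (subst sum.swap) (simp add: mult.assoc)
      also have "\<dots> = - (\<Sum>m<n. (\<Sum>b<n. B j b * D i (M b m)) * B m i)"
        by (simp add: * sum_negf)
      also have "(\<Sum>m<n. (\<Sum>b<n. B j b * D i (M b m)) * B m i) =
          (\<Sum>b<n. B j b * (\<Sum>m<n. D i (M b m) * B m i))"
        unfolding sum_distrib_left sum_distrib_right by (subst sum.swap) (simp add: mult.assoc)
      also have "\<dots> = (\<Sum>b<n. B j b * (\<Sum>m<n. D b (M i m) * B m i))"
        by (intro sum.cong refl arg_cong2[of _ _ _ _ "(*)"] closed) (use i in auto)
      finally show ?thesis .
    qed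
    \<comment> \<open>By Jacobi's formula this trace is the logarithmic derivative of the
      determinant, which is annihilated by \<open>D b\<close>.\<close>
    have trace: "(\<Sum>i<n. \<Sum>m<n. D b (M i m) * B m i) = 0" for b
    proof -
      interpret derivation "D b" by (rule D)
      have "(\<Sum>i<n. \<Sum>m<n. D b (M i m) * B m i) = c * D b (det A)"
        unfolding det[OF A] sum_distrib_left
        by (intro sum.cong refl) (simp add: A_def B_def mult_ac)
      then show ?thesis using const by (simp add: A_def)
    qed
    have "(\<Sum>i<n. D i (B j i)) = - (\<Sum>i<n. \<Sum>b<n. B j b * (\<Sum>m<n. D b (M i m) * B m i))"
      by (simp add: DB sum_negf)
    also have "(\<Sum>i<n. \<Sum>b<n. B j b * (\<Sum>m<n. D b (M i m) * B m i)) =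
        (\<Sum>b<n. B j b * (\<Sum>i<n. \<Sum>m<n. D b (M i m) * B m i))"
      by (subst sum.swap) (simp only: sum_distrib_left)
    finally show ?thesis by (simp add: trace)
  qed
  with BM that show ?thesis by blast
qed

text \<open>Meant for F = u^k: the j-th dual field takes log u_l to the Kronecker delta and so
  multiplies u^k by k_j. Zero divergence allows the derivations to be moved outermost.\<close>

lemma logarithmic_field_is_divergence:
  fixes D :: "nat \<Rightarrow> 'r::comm_ring_1 \<Rightarrow> 'r" and M B :: "nat \<Rightarrow> nat \<Rightarrow> 'r"
  assumes D: "\<And>i. derivation (D i)"
    and dual: "\<And>l. l < n \<Longrightarrow> (\<Sum>i<n. B j i * M i l) = of_bool (j = l)"
    and div: "(\<Sum>i<n. D i (B j i)) = 0"
    and F: "\<And>i. i < n \<Longrightarrow> D i F = F * (\<Sum>l<n. of_int (k l) * M i l)"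
    and j: "j < n"
  shows "of_int (k j) * F = (\<Sum>i<n. D i (B j i * F))"
proof -
  have "(\<Sum>i<n. D i (B j i * F)) = (\<Sum>i<n. D i (B j i) * F + B j i * D i F)"
    by (simp add: derivation.mult[OF D])
  also have "\<dots> = (\<Sum>i<n. B j i * D i F)"
    by (simp add: sum.distrib div flip: sum_distrib_right)
  also have "\<dots> = F * (\<Sum>i<n. \<Sum>l<n. of_int (k l) * (B j i * M i l))"
    unfolding sum_distrib_left by (intro sum.cong refl) (simp add: F sum_distrib_left mult_ac)
  also have "(\<Sum>i<n. \<Sum>l<n. of_int (k l) * (B j i * M i l)) = (\<Sum>l<n. of_int (k l) * (\<Sum>i<n. B j i * M i l))"
    by (subst sum.swap) (simp only: sum_distrib_left)
  also have "\<dots> = of_int (k j)" using j by (simp add: dual)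
  finally show ?thesis by (simp add: mult.commute)
qed

section \<open>The logarithmic Jacobian\<close>

text \<open>Collects the inverses of the variables, of their differences and of 2. Indices start at
  0 here, whereas the series are indexed by 1, ..., n.\<close>

locale distinct_units =
  fixes n :: nat and z zi :: "nat \<Rightarrow> 'r::comm_ring_1" and w :: "nat \<Rightarrow> nat \<Rightarrow> 'r" and half :: 'r
  assumes zi: "i < n \<Longrightarrow> z i * zi i = 1"
    and w: "\<lbrakk>i < n; b < n; i \<noteq> b\<rbrakk> \<Longrightarrow> (z i - z b) * w i b = 1"
    and half: "2 * half = 1"
begin

lemma eq_0_if_eq_uminus:
  assumes "(x :: 'r) = - x"
  shows "x = 0"
proof -
  have "x = (2 * x) * half" using half by (metis mult.assoc mult.commute mult_1)
  moreover have "2 * x = 0" using assms by (metis add.right_inverse mult_2)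
  ultimately show ?thesis by simp
qed

lemma w_swap:
  assumes "i < n" "b < n" "i \<noteq> b"
  shows "w b i = - w i b"
proof -
  have "w b i = w b i * ((z i - z b) * w i b)" using assms by (simp add: w)
  also have "\<dots> = - ((z b - z i) * w b i) * w i b" by (simp add: algebra_simps)
  also have "\<dots> = - w i b" using assms w[of b i] by simp
  finally show ?thesis .
qed

text \<open>This is D_i (log u_l). A factor of u_l containing z_i and z_b gives z_i / (z_i - z_b),
  whichever of them comes first; for i = l only the power z_l^r contributes.\<close>

definition log_jacobian :: "int \<Rightarrow> nat \<Rightarrow> nat \<Rightarrow> 'r" where
  "log_jacobian r i l = (if i = l then of_int r else \<Sum>b\<in>{..<n} - {i, l}. z i * w i b)"

text \<open>Exchanging i and b shows that twice this sum consists of the quotients (z_i^t - z_b^t) /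
  (z_i - z_b). They are 0 for t = 0 and 1 for t = 1.\<close>

definition theta :: "nat \<Rightarrow> 'r" where
  "theta t = (\<Sum>i<n. \<Sum>b\<in>{..<n} - {i}. z i ^ t * w i b)"

lemma theta_swap: "theta t = - (\<Sum>i<n. \<Sum>b\<in>{..<n} - {i}. z b ^ t * w i b)"
proof -
  have "theta t = (\<Sum>i<n. \<Sum>b<n. if b = i then 0 else z i ^ t * w i b)"
    unfolding theta_def
    by (intro sum.cong refl sum.mono_neutral_cong_left) auto
  also have "\<dots> = (\<Sum>b<n. \<Sum>i<n. if b = i then 0 else z i ^ t * w i b)"
    by (rule sum.swap)
  also have "\<dots> = (\<Sum>i<n. \<Sum>b\<in>{..<n} - {i}. z b ^ t * w b i)"
    by (intro sum.cong refl sum.mono_neutral_cong_right) auto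
  also have "\<dots> = (\<Sum>i<n. \<Sum>b\<in>{..<n} - {i}. - (z b ^ t * w i b))"
  proof (intro sum.cong refl)
    fix i b assume "i \<in> {..<n}" "b \<in> {..<n} - {i}"
    then show "z b ^ t * w b i = - (z b ^ t * w i b)"
      using w_swap[of i b] by auto
  qed
  finally show ?thesis by (simp add: sum_negf)
qed

lemma theta_0: "theta 0 = 0"
  using theta_swap[of 0] by (intro eq_0_if_eq_uminus) (simp add: theta_def)

lemma theta_1: "theta 1 = of_nat (n choose 2)"
proof -
  have "2 * theta 1 = theta 1 - (\<Sum>i<n. \<Sum>b\<in>{..<n} - {i}. z b ^ 1 * w i b)"
    unfolding mult_2 by (subst (2) theta_swap) (simp only: diff_conv_add_uminus)
  also have "\<dots> = (\<Sum>i<n. \<Sum>b\<in>{..<n} - {i}. (z i - z b) * w i b)"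
    by (simp add: theta_def sum_subtractf left_diff_distrib)
  also have "\<dots> = (\<Sum>i<n. \<Sum>b\<in>{..<n} - {i}. 1)"
    by (intro sum.cong refl) (auto simp: w)
  also have "\<dots> = (of_nat (n * (n - 1)) :: 'r)"
    by (cases n) (simp_all add: algebra_simps)
  also have "n * (n - 1) = 2 * (n choose 2)"
    using dvd_mult_div_cancel[of 2 "n * (n - 1)"] by (cases n) (auto simp: choose_two)
  finally have "2 * (theta 1 - of_nat (n choose 2)) = 0"
    by (simp add: right_diff_distrib)
  then have "half * 2 * (theta 1 - of_nat (n choose 2)) = 0" by (simp add: mult.assoc)
  then show ?thesis using half by (simp add: mult.commute)
qed

definition psum :: "nat \<Rightarrow> 'r" where "psum t = (\<Sum>i<n. z i ^ t)"

text \<open>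
  The matrix of the transposed logarithmic Jacobian in the basis of the vectors
  \<open>(z l ^ (t - 1))\<^sub>l\<close>; the power sums arise from \<open>(x\<^sup>t - y\<^sup>t) / (x - y)\<close>.
\<close>

definition tri :: "int \<Rightarrow> nat \<Rightarrow> nat \<Rightarrow> 'r" where
  "tri r s t = (if s = t then of_int r + of_nat t else 0) + (if s = 1 then theta t else 0)
     - (if 1 \<le> s \<and> s \<le> t then psum (t - s) else 0)"

text \<open>Extending the inner sums to all b different from i, and the outer sum to i = l, yields
  \<open>theta t\<close>. The terms added for b = l and for i = l combine into divided differences,
  whose denominators cancel.\<close>

lemma log_jacobian_power:
  assumes l: "l < n"
  shows "(\<Sum>i<n. log_jacobian r i l * (zi i * z i ^ t)) =
    of_int r * (zi l * z l ^ t) + theta t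
      - (\<Sum>i\<in>{..<n} - {l}. \<Sum>a<t. z i ^ (t - Suc a) * z l ^ a)"
proof -
  have "(\<Sum>i<n. log_jacobian r i l * (zi i * z i ^ t)) = of_int r * (zi l * z l ^ t) +
      (\<Sum>i\<in>{..<n} - {l}. log_jacobian r i l * (zi i * z i ^ t))"
    using l by (subst sum.remove[of _ l]) (auto simp: log_jacobian_def)
  also have "(\<Sum>i\<in>{..<n} - {l}. log_jacobian r i l * (zi i * z i ^ t)) =
      (\<Sum>i\<in>{..<n} - {l}. (\<Sum>b\<in>{..<n} - {i}. z i ^ t * w i b) - z i ^ t * w i l)"
  proof (intro sum.cong refl)
    fix i assume i: "i \<in> {..<n} - {l}"
    have "log_jacobian r i l * (zi i * z i ^ t) =
        (\<Sum>b\<in>{..<n} - {i, l}. (z i * zi i) * (z i ^ t * w i b))"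
      using i by (simp add: log_jacobian_def sum_distrib_left sum_distrib_right mult_ac)
    also have "\<dots> = (\<Sum>b\<in>{..<n} - {i} - {l}. z i ^ t * w i b)"
      using i by (intro sum.cong) (auto simp: zi)
    also have "\<dots> = (\<Sum>b\<in>{..<n} - {i}. z i ^ t * w i b) - z i ^ t * w i l"
      using i l by (simp add: sum.remove[of "{..<n} - {i}" l])
    finally show "log_jacobian r i l * (zi i * z i ^ t) =
        (\<Sum>b\<in>{..<n} - {i}. z i ^ t * w i b) - z i ^ t * w i l" .
  qed
  also have "\<dots> = theta t - (\<Sum>b\<in>{..<n} - {l}. z l ^ t * w l b) - (\<Sum>i\<in>{..<n} - {l}. z i ^ t * w i l)"
    unfolding theta_def sum_subtractf using l by (simp add: sum.remove[of "{..<n}" l])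
  also have "\<dots> = theta t - (\<Sum>i\<in>{..<n} - {l}. (z l ^ t - z i ^ t) * w l i)"
  proof -
    have "(\<Sum>i\<in>{..<n} - {l}. (z l ^ t - z i ^ t) * w l i) =
        (\<Sum>i\<in>{..<n} - {l}. z l ^ t * w l i + z i ^ t * w i l)"
    proof (intro sum.cong refl)
      fix i assume "i \<in> {..<n} - {l}"
      then show "(z l ^ t - z i ^ t) * w l i = z l ^ t * w l i + z i ^ t * w i l"
        using w_swap[of l i] l by (auto simp: algebra_simps)
    qed
    then show ?thesis by (simp add: sum.distrib)
  qed
  also have "(\<Sum>i\<in>{..<n} - {l}. (z l ^ t - z i ^ t) * w l i) =
      (\<Sum>i\<in>{..<n} - {l}. \<Sum>a<t. z i ^ (t - Suc a) * z l ^ a)"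
  proof (intro sum.cong refl)
    fix i assume i: "i \<in> {..<n} - {l}"
    have "(z l ^ t - z i ^ t) * w l i =
        ((z l - z i) * w l i) * (\<Sum>a<t. z i ^ (t - Suc a) * z l ^ a)"
      unfolding power_diff_sumr2 by (simp add: mult_ac)
    then show "(z l ^ t - z i ^ t) * w l i = (\<Sum>a<t. z i ^ (t - Suc a) * z l ^ a)"
      using i l by (simp add: w)
  qed
  finally show ?thesis by (simp add: algebra_simps)
qed

lemma log_jacobian_triangular:
  assumes l: "l < n" and t: "t < n"
  shows "(\<Sum>i<n. log_jacobian r i l * (zi i * z i ^ t)) = (\<Sum>s<n. (zi l * z l ^ s) * tri r s t)"
proof -
  have zl: "zi l * z l ^ Suc a = z l ^ a" for a
    using zi[OF l] by (metis mult.assoc mult.commute mult_1 power_Suc)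
  \<comment> \<open>\<open>psum\<close> includes i = l; the t surplus copies of z_l^(t-1) produce
    the summand \<open>of_nat t\<close> on the diagonal of \<open>tri\<close>.\<close>
  have "(\<Sum>i\<in>{..<n} - {l}. \<Sum>a<t. z i ^ (t - Suc a) * z l ^ a) =
      (\<Sum>a<t. z l ^ a * (psum (t - Suc a) - z l ^ (t - Suc a)))"
  proof -
    have "psum q - z l ^ q = (\<Sum>i\<in>{..<n} - {l}. z i ^ q)" for q
      unfolding psum_def using l by (simp add: sum.remove[of "{..<n}" l])
    then show ?thesis by (subst sum.swap) (simp add: sum_distrib_left mult.commute)
  qed
  also have "\<dots> = (\<Sum>a<t. z l ^ a * psum (t - Suc a)) - (\<Sum>a<t. z l ^ (t - 1))"
    by (simp add: right_diff_distrib sum_subtractf flip: power_add)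
  also have "(\<Sum>a<t. z l ^ (t - 1)) = of_nat t * (zi l * z l ^ t)"
    using zl[of "t - 1"] by (cases t) auto
  also have "(\<Sum>a<t. z l ^ a * psum (t - Suc a)) = (\<Sum>s\<in>{1..t}. (zi l * z l ^ s) * psum (t - s))"
    by (rule sum.reindex_bij_witness[of _ "\<lambda>s. s - 1" Suc])
       (auto simp: zl simp del: power_Suc)
  also have "\<dots> = (\<Sum>s<n. if 1 \<le> s \<and> s \<le> t then (zi l * z l ^ s) * psum (t - s) else 0)"
    using t by (intro sum.mono_neutral_cong_left) auto
  finally have *: "(\<Sum>i\<in>{..<n} - {l}. \<Sum>a<t. z i ^ (t - Suc a) * z l ^ a) =
    (\<Sum>s<n. if 1 \<le> s \<and> s \<le> t then (zi l * z l ^ s) * psum (t - s) else 0) - of_nat t * (zi l * z l ^ t)" .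
  \<comment> \<open>\<open>theta t\<close> multiplies the constant vector, the basis vector with s =
    1. For n = 1 that vector is absent, but then t = 0 and \<open>theta t\<close> vanishes.\<close>
  have th: "(\<Sum>s<n. if s = 1 then (zi l * z l ^ s) * theta t else 0) = theta t"
  proof (cases "1 < n")
    case True
    then show ?thesis using zl[of 0] by simp
  next
    case False
    with t have "t = 0" by simp
    then show ?thesis by (simp add: theta_0)
  qed
  have "(\<Sum>s<n. (zi l * z l ^ s) * tri r s t) =
     (\<Sum>s<n. if s = t then (zi l * z l ^ s) * (of_int r + of_nat t) else 0) +
     (\<Sum>s<n. if s = 1 then (zi l * z l ^ s) * theta t else 0) -
     (\<Sum>s<n. if 1 \<le> s \<and> s \<le> t then (zi l * z l ^ s) * psum (t - s) else 0)"
    unfolding sum.distrib[symmetric] sum_subtractf[symmetric]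
    by (intro sum.cong refl) (auto simp: tri_def algebra_simps)
  then show ?thesis
    unfolding log_jacobian_power[OF l] * th using t by (simp add: algebra_simps)
qed

text \<open>The term - n is \<open>psum 0\<close>. At t = 1, Pascal's rule absorbs 1 - n into
  \<open>theta 1\<close> and lowers the binomial coefficient.\<close>

lemma tri_diagonal:
  assumes "t < n"
  shows "tri r t t = of_int (if t = 0 then r else if t = 1 then r + int ((n - 1) choose 2) else r + int t - int n)"
proof -
  have "psum 0 = of_nat n" by (simp add: psum_def)
  moreover have "n choose 2 = (n - 1) + ((n - 1) choose 2)" if "n > 0"
    using that by (cases n) (simp_all add: numeral_2_eq_2)
  moreover have "theta (Suc 0) = of_nat (n choose 2)" using theta_1 by simp
  ultimately show ?thesis
    using assms by (auto simp: tri_def theta_0)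
qed

text \<open>Interpolation polynomials: their coefficients invert the matrix of powers of the z_l,
  whose determinant is thus a unit without being computed.\<close>

definition lagrange :: "nat \<Rightarrow> 'r poly" where
  "lagrange l = (\<Prod>i\<in>{..<n} - {l}. smult (w l i) [:- z i, 1:])"

lemma poly_lagrange:
  assumes "l < n" "m < n"
  shows "poly (lagrange l) (z m) = of_bool (l = m)"
proof (cases "l = m")
  case True
  have "poly (lagrange l) (z m) = (\<Prod>i\<in>{..<n} - {l}. 1)"
    unfolding lagrange_def poly_prod
  proof (intro prod.cong refl)
    fix i assume "i \<in> {..<n} - {l}"
    then show "poly (smult (w l i) [:- z i, 1:]) (z m) = 1"
      using w[of l i] assms True by (auto simp: algebra_simps)
  qed
  with True show ?thesis by simp
next
  case False
  then have "\<exists>i\<in>{..<n} - {l}. poly (smult (w l i) [:- z i, 1:]) (z m) = 0"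
    using assms by (intro bexI[of _ m]) auto
  then show ?thesis
    using False unfolding lagrange_def poly_prod by (simp add: prod_zero)
qed

lemma degree_lagrange:
  assumes "l < n"
  shows "degree (lagrange l) < n"
proof -
  have "degree (lagrange l) \<le> (\<Sum>i\<in>{..<n} - {l}. degree (smult (w l i) [:- z i, 1:]))"
    unfolding lagrange_def using degree_prod_sum_le[of "{..<n} - {l}" "\<lambda>i. smult (w l i) [:- z i, 1:]"]
    by (simp add: o_def)
  also have "\<dots> \<le> (\<Sum>i\<in>{..<n} - {l}. 1)"
    by (intro sum_mono order.trans[OF degree_smult_le]) simp
  also have "\<dots> < n" using assms by simp
  finally show ?thesis .
qed

lemma det_log_jacobian:
  "det (mat n n (\<lambda>(i, l). log_jacobian r i l)) =
    of_int (\<Prod>t<n. if t = 0 then r else if t = 1 then r + int ((n - 1) choose 2) else r + int t - int n)"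
proof -
  define L where "L = mat n n (\<lambda>(i, l). log_jacobian r i l)"
  define S where "S = mat n n (\<lambda>(l, t). zi l * z l ^ t)"
  define T where "T = mat n n (\<lambda>(s, t). tri r s t)"
  define C where "C = mat n n (\<lambda>(t, l). coeff (lagrange l) t * z l)"
  have [simp]: "L \<in> carrier_mat n n" "S \<in> carrier_mat n n" "T \<in> carrier_mat n n" "C \<in> carrier_mat n n"
    by (auto simp: L_def S_def T_def C_def)
  \<comment> \<open>The change of basis is stated without an inverse; the unit \<open>det S\<close>
    is cancelled later.\<close>
  have LS: "transpose_mat L * S = S * T"
    by (rule eq_matI)
       (auto simp: L_def S_def T_def scalar_prod_def atLeast0LessThan log_jacobian_triangular)
  have SC: "S * C = 1\<^sub>m n"
  proof (rule eq_matI)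
    fix l m assume lm: "l < dim_row (1\<^sub>m n)" "m < dim_col (1\<^sub>m n)"
    then have "(S * C) $$ (l, m) = zi l * z m * (\<Sum>t<n. coeff (lagrange m) t * z l ^ t)"
      by (auto simp: S_def C_def scalar_prod_def atLeast0LessThan sum_distrib_left mult_ac intro!: sum.cong)
    also have "(\<Sum>t<n. coeff (lagrange m) t * z l ^ t) = poly (lagrange m) (z l)"
      unfolding poly_altdef using degree_lagrange[of m] lm
      by (intro sum.mono_neutral_right) (auto simp: coeff_eq_0)
    finally show "(S * C) $$ (l, m) = 1\<^sub>m n $$ (l, m)"
      using lm zi by (auto simp: poly_lagrange mult.commute)
  qed (auto simp: S_def C_def)
  have S1: "det S * det C = 1"
    using det_mult[of S n C] by (simp add: SC)
  have "det L * det S = det S * det T"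
    using det_mult[of "transpose_mat L" n S] det_mult[of S n T] LS det_transpose[of L n] by simp
  then have "det L * (det S * det C) = det T * (det S * det C)"
    by (metis mult.assoc mult.commute)
  then have "det L = det T" by (simp add: S1)
  \<comment> \<open>Below the diagonal the only candidate is \<open>theta 0\<close>, in position (1,
    0), and it vanishes.\<close>
  also have "\<dots> = (\<Prod>t<n. tri r t t)"
    by (subst det_upper_triangular[of _ n])
       (auto simp: T_def prod_list_diag_prod atLeast0LessThan tri_def theta_0 upper_triangular_def
          not_le)
  finally show ?thesis by (simp add: L_def tri_diagonal)
qed

end

section \<open>Leading exponents\<close>

text \<open>The additive monoid generated by \<open>D\<close>. Prescribing the generators in advance
  confines infinitely many supports to translates of one well-ordered set.\<close>

inductive_set mcone :: "'g::ab_group_add set \<Rightarrow> 'g set" for D where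
  zero: "0 \<in> mcone D"
| step: "\<lbrakk>d \<in> D; x \<in> mcone D\<rbrakk> \<Longrightarrow> d + x \<in> mcone D"

lemma mcone_add: "\<lbrakk>x \<in> mcone D; y \<in> mcone D\<rbrakk> \<Longrightarrow> x + y \<in> mcone D"
  by (induction rule: mcone.induct) (auto intro: mcone.intros simp: add.assoc)

lemma mcone_nonneg:
  fixes D :: "'g::linordered_ab_group_add set"
  assumes "\<And>d. d \<in> D \<Longrightarrow> 0 < d" and "x \<in> mcone D"
  shows "0 \<le> x"
  using assms(2) by induction (auto dest: assms(1))

lemma mcone_insert: "mcone (insert d D) \<subseteq> (\<lambda>(a, b). a + b) ` (mcone {d} \<times> mcone D)"
proof
  fix x assume "x \<in> mcone (insert d D)"
  then show "x \<in> (\<lambda>(a, b). a + b) ` (mcone {d} \<times> mcone D)"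
  proof induction
    case zero
    show ?case by (rule image_eqI[of _ _ "(0, 0)"]) (auto intro: mcone.zero)
  next
    case (step d' x)
    then obtain a b where ab: "x = a + b" "a \<in> mcone {d}" "b \<in> mcone D" by auto
    from step(1) show ?case
    proof
      assume "d' = d"
      with ab show ?case
        by (intro image_eqI[of _ _ "(d + a, b)"]) (auto intro: mcone.step simp: add.assoc)
    next
      assume "d' \<in> D"
      with ab show ?case
        by (intro image_eqI[of _ _ "(a, d' + b)"]) (auto intro!: mcone.step simp: add.left_commute)
    qed
  qed
qed

lemma mcone_singleton_iff: "x \<in> mcone {d} \<longleftrightarrow> x = 0 \<or> x - d \<in> mcone {d}"
proof
  show "x \<in> mcone {d} \<Longrightarrow> x = 0 \<or> x - d \<in> mcone {d}" by (auto elim: mcone.cases)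
  show "x = 0 \<or> x - d \<in> mcone {d} \<Longrightarrow> x \<in> mcone {d}"
    using mcone.step[of d "{d}" "x - d"] by (auto intro: mcone.zero)
qed

lemma wfp_on_mcone_singleton:
  fixes d :: "'g::linordered_ab_group_add"
  assumes d: "0 < d"
  shows "wfp_on (mcone {d}) (<)"
proof (unfold wfp_on_iff_ex_minimal, intro allI impI)
  fix B assume B: "B \<subseteq> mcone {d}" "B \<noteq> {}"
  define f where "f p = ((+) d ^^ p) 0" for p
  have f: "\<exists>p. x = f p" if "x \<in> mcone {d}" for x
    using that
  proof induction
    case zero
    show ?case by (rule exI[of _ 0]) (simp add: f_def)
  next
    case (step d' x)
    then obtain p where "x = f p" by auto
    with step show ?case by (intro exI[of _ "Suc p"]) (simp add: f_def)
  qed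
  have mono: "f p \<le> f q" if "p \<le> q" for p q
    using d by (intro lift_Suc_mono_le[OF _ that]) (simp add: f_def less_imp_le)
  from B f obtain p0 where "f p0 \<in> B" by blast
  then have "f (LEAST p. f p \<in> B) \<in> B" by (rule LeastI)
  moreover have "f (LEAST p. f p \<in> B) \<le> y" if "y \<in> B" for y
  proof -
    from that B(1) f obtain p where "y = f p" by blast
    with that show ?thesis by (auto intro!: mono Least_le)
  qed
  ultimately show "\<exists>z\<in>B. \<forall>y. y < z \<longrightarrow> y \<notin> B" by (meson not_less)
qed

text \<open>The cone lies in a sum of finitely many chains 0, d, 2d, ..., and sumsets of
  well-ordered sets are well-ordered.\<close>

lemma wfp_on_mcone:
  fixes D :: "'g::linordered_ab_group_add set"
  assumes "finite D" and "\<And>d. d \<in> D \<Longrightarrow> 0 < d"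
  shows "wfp_on (mcone D) (<)"
  using assms
proof (induction D rule: finite_induct)
  case empty
  have "mcone {} \<subseteq> {0 :: 'g}" by (auto elim: mcone.cases)
  then show ?case by (rule wfp_on_subset[rotated]) (auto simp: wfp_on_def)
next
  case (insert d D)
  have "wfp_on (mcone D) (<)" by (rule insert.IH) (use insert.prems in auto)
  moreover have "wfp_on (mcone {d}) (<)" by (rule wfp_on_mcone_singleton) (use insert.prems in auto)
  ultimately show ?case
    using wfp_on_subset[OF wfp_on_less_image_plus mcone_insert] by blast
qed

lemma mcone_mono: "D \<subseteq> E \<Longrightarrow> mcone D \<subseteq> mcone E"
proof
  fix x assume "D \<subseteq> E" "x \<in> mcone D"
  from this(2,1) show "x \<in> mcone E" by induction (auto intro: mcone.intros)
qed

definition leads :: "'g set \<Rightarrow> ('g::linordered_ab_group_add, 'a::zero) hahn \<Rightarrow> 'g \<Rightarrow> bool" where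
  "leads D f b \<longleftrightarrow> hcoeff f b \<noteq> 0 \<and> (\<forall>k\<in>hsupp f. k - b \<in> mcone D)"

text \<open>The inverse is carried along because negative powers need the same control of their
  supports.\<close>

definition unit_leads ::
    "'g set \<Rightarrow> ('g::linordered_ab_group_add, 'a::comm_ring_1) hahn \<Rightarrow> ('g, 'a) hahn \<Rightarrow> 'g \<Rightarrow> bool" where
  "unit_leads D f f' b \<longleftrightarrow> f * f' = 1 \<and> leads D f b \<and> leads D f' (- b)"

lemma leads_single: "c \<noteq> 0 \<Longrightarrow> leads D (single b c) b"
  by (auto simp: leads_def hsupp_def hcoeff_single mcone.zero split: if_splits)

text \<open>Elements of the cone are nonnegative, so only the pair of exponents (b, c) contributes
  at b + c and nothing can cancel there.\<close>

lemma leads_mult: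
  fixes f g :: "('g::linordered_ab_group_add, 'a::idom) hahn"
  assumes D: "\<And>d. d \<in> D \<Longrightarrow> 0 < d" and f: "leads D f b" and g: "leads D g c"
  shows "leads D (f * g) (b + c)"
proof -
  have "hcoeff (f * g) (b + c) = (\<Sum>k\<in>{b}. hcoeff f k * hcoeff g (b + c - k))"
  proof (rule hcoeff_mult_superset)
    fix k assume k: "k \<in> hsupp f" "b + c - k \<in> hsupp g"
    then have "0 \<le> k - b" "0 \<le> b + c - k - c"
      using mcone_nonneg[OF D] f g unfolding leads_def by blast+
    then show "k \<in> {b}" by (simp add: algebra_simps)
  qed simp
  then have "hcoeff (f * g) (b + c) \<noteq> 0" using f g by (simp add: leads_def)
  moreover have "k - (b + c) \<in> mcone D" if k: "k \<in> hsupp (f * g)" for k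
  proof -
    obtain x y where "k = x + y" "x \<in> hsupp f" "y \<in> hsupp g"
      using subsetD[OF hsupp_mult k] by auto
    then show ?thesis
      using mcone_add[of "x - b" D "y - c"] f g by (auto simp: leads_def algebra_simps)
  qed
  ultimately show ?thesis by (simp add: leads_def)
qed

lemma unit_leads_swap: "unit_leads D f f' b \<Longrightarrow> unit_leads D f' f (- b)"
  by (simp add: unit_leads_def mult.commute)

lemma unit_leads_mult:
  fixes f g :: "('g::linordered_ab_group_add, 'a::idom) hahn"
  assumes D: "\<And>d. d \<in> D \<Longrightarrow> 0 < d" and f: "unit_leads D f f' b" and g: "unit_leads D g g' c"
  shows "unit_leads D (f * g) (f' * g') (b + c)"
proof -
  have "f * g * (f' * g') = (f * f') * (g * g')" by (simp add: mult_ac)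
  also have "\<dots> = 1" using f g by (simp add: unit_leads_def)
  finally show ?thesis
    using leads_mult[where D = D, OF D, where f = f and g = g and b = b and c = c]
      leads_mult[where D = D, OF D, where f = f' and g = g' and b = "- b" and c = "- c"] f g
    by (simp add: unit_leads_def)
qed

lemma unit_leads_1: "unit_leads D (1 :: ('g::linordered_ab_group_add, 'a::comm_ring_1) hahn) 1 0"
  using leads_single[of "1 :: 'a" D 0] by (simp add: unit_leads_def single_0_1)

lemma unit_leads_prod:
  fixes f :: "'i \<Rightarrow> ('g::linordered_ab_group_add, 'a::idom) hahn"
  assumes D: "\<And>d. d \<in> D \<Longrightarrow> 0 < d" and f: "\<And>a. a \<in> A \<Longrightarrow> unit_leads D (f a) (f' a) (b a)"
  shows "unit_leads D (prod f A) (prod f' A) (sum b A)"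
  using f
proof (induction A rule: infinite_finite_induct)
  case (insert x A)
  then show ?case by (simp add: unit_leads_mult[OF D])
qed (auto simp: unit_leads_1)

lemma unit_leads_single:
  "c * c' = 1 \<Longrightarrow> unit_leads D (single b c) (single (- b) (c' :: 'a::idom)) b"
  by (auto simp: unit_leads_def single_mult_single single_0_1 intro!: leads_single)

text \<open>The expansion of 1 / (1 - z^d). The guard \<open>0 < d\<close> makes the definition
  total, since the multiples of a negative \<open>d\<close> are not well-ordered.\<close>

lift_definition geometric :: "'g::linordered_ab_group_add \<Rightarrow> ('g, 'a::comm_ring_1) hahn"
  is "\<lambda>d k. if 0 < d \<and> k \<in> mcone {d} then 1 else 0"
proof -
  fix d :: 'g
  show "wfp_on {k. (if 0 < d \<and> k \<in> mcone {d} then 1 else 0 :: 'a) \<noteq> 0} (<)"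
  proof (cases "0 < d")
    case True
    show ?thesis by (rule wfp_on_subset[OF wfp_on_mcone_singleton[OF True]]) auto
  next
    case False
    then have "{k. (if 0 < d \<and> k \<in> mcone {d} then 1 else 0 :: 'a) \<noteq> 0} = {}" by simp
    then show ?thesis by (simp only: wfp_on_def) simp
  qed
qed

lemma geometric: "0 < d \<Longrightarrow> (1 - single d 1) * geometric d = (1 :: ('g::linordered_ab_group_add, 'a::comm_ring_1) hahn)"
proof (rule hahn_eqI)
  fix k assume d: "0 < d"
  \<comment> \<open>Hence the shifted series does not reach exponent 0; at every other exponent the
    series and its shift agree.\<close>
  have "- d \<notin> mcone {d}" using mcone_nonneg[of "{d}" "- d"] d by auto
  then show "hcoeff ((1 - single d 1) * geometric d) k = hcoeff (1 :: ('g, 'a) hahn) k"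
    using d mcone_singleton_iff[of k d]
    by (auto simp: left_diff_distrib hcoeff_single_mult geometric.rep_eq hcoeff_1 mcone.zero)
qed

lemma unit_leads_geometric:
  assumes "d \<in> D" and d: "0 < d"
  shows "unit_leads D (1 - single d 1) (geometric d :: ('g::linordered_ab_group_add, 'a::idom) hahn) 0"
    (is "unit_leads D ?f ?g 0")
proof -
  have "hsupp ?f \<subseteq> {0, d}" by (auto simp: hsupp_def hcoeff_1 hcoeff_single split: if_splits)
  moreover have "d \<in> mcone D" using mcone.step[OF assms(1) mcone.zero] by simp
  ultimately have "leads D ?f 0"
    using d by (auto simp: leads_def hcoeff_1 hcoeff_single mcone.zero)
  moreover have "mcone {d} \<subseteq> mcone D" using assms(1) by (intro mcone_mono) auto
  then have "leads D ?g 0"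
    using d by (auto simp: leads_def hsupp_def geometric.rep_eq mcone.zero split: if_splits)
  ultimately show ?thesis using geometric[OF d] by (simp add: unit_leads_def)
qed

section \<open>Integer powers of units\<close>

text \<open>Meaningful only if \<open>x'\<close> is the inverse of \<open>x\<close>.\<close>

definition zpow :: "'r::monoid_mult \<Rightarrow> 'r \<Rightarrow> int \<Rightarrow> 'r" where
  "zpow x x' k = (if 0 \<le> k then x ^ nat k else x' ^ nat (- k))"

context derivation
begin

lemma dlog_mult:
  assumes "x * x' = 1" "y * y' = 1"
  shows "d (x * y) * (x' * y') = d x * x' + d y * y'"
proof -
  have "d (x * y) * (x' * y') = d x * x' * (y * y') + d y * y' * (x * x')"
    by (simp add: mult algebra_simps)
  then show ?thesis using assms by simp
qed

lemma dlog_prod: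
  assumes "\<And>a. a \<in> A \<Longrightarrow> f a * f' a = 1"
  shows "d (prod f A) * prod f' A = (\<Sum>a\<in>A. d (f a) * f' a)"
  using assms
proof (induction A rule: infinite_finite_induct)
  case (insert x A)
  then have "prod f A * prod f' A = 1" by (simp flip: prod.distrib)
  with insert show ?case by (simp add: dlog_mult)
qed auto

lemma dlog_power:
  assumes "x * x' = 1"
  shows "d (x ^ k) * x' ^ k = of_nat k * (d x * x')"
  using dlog_prod[of "{..<k}" "\<lambda>_. x" "\<lambda>_. x'"] assms by simp

lemma dlog_inverse:
  assumes "x * x' = 1"
  shows "d x' * x = - (d x * x')"
proof -
  have "d x' * x = - (d x * x') * (x * x')"
    by (simp add: inverse[OF assms] mult_ac)
  then show ?thesis by (simp add: assms)
qed

lemma dlog_zpow: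
  assumes "x * x' = 1"
  shows "d (zpow x x' k) * zpow x' x k = of_int k * (d x * x')"
proof (cases "0 \<le> k")
  case True
  then show ?thesis using dlog_power[OF assms, of "nat k"] by (simp add: zpow_def)
next
  case False
  have "x' * x = 1" using assms by (simp add: mult.commute)
  from dlog_power[OF this, of "nat (- k)"] False show ?thesis
    by (simp add: zpow_def dlog_inverse[OF assms])
qed

end

lemma zpow_mult_zpow:
  fixes x :: "'r::comm_monoid_mult"
  assumes "x * x' = 1"
  shows "zpow x x' k * zpow x' x k = 1"
  using assms by (auto simp: zpow_def mult.commute simp flip: power_mult_distrib)

text \<open>By the rule for inverses both sides expand to d(e x) x' - d(x) e(x) x'^2, which is
  symmetric for commuting derivations.\<close>

lemma dlog_closed:
  assumes "derivation d" "derivation e" "\<And>x. d (e x) = e (d x)" "x * x' = 1"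
  shows "d (e x * x') = e (d x * x')"
  using assms(3) by (simp add: derivation.mult[OF assms(1)] derivation.mult[OF assms(2)]
      derivation.inverse[OF assms(1,4)] derivation.inverse[OF assms(2,4)] mult_ac)

section \<open>Exponent vectors with the reverse lexicographic ordering\<close>

text \<open>Finite support makes the reverse lexicographic order total: two distinct vectors have a
  largest index at which they differ. No bound \<open>n\<close> enters the type.\<close>

typedef expv = "{k :: expo. finite {i. k i \<noteq> 0}}"
  morphisms ev Abs_expv
  by (rule exI[of _ "\<lambda>_. 0"]) simp

setup_lifting type_definition_expv

lemma finite_ev: "finite {i. ev e i \<noteq> 0}"
  using ev[of e] by simp

lemma expv_eqI: "(\<And>i. ev a i = ev b i) \<Longrightarrow> a = b"
  by (simp add: ev_inject[symmetric] fun_eq_iff)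

lemma revlex_less_irrefl: "\<not> revlex_less k k"
  by (auto simp: revlex_less_def)

lemma revlex_less_trans: "\<lbrakk>revlex_less k l; revlex_less l m\<rbrakk> \<Longrightarrow> revlex_less k m"
  unfolding revlex_less_def
proof (elim exE conjE)
  fix i i'
  assume "k i < l i" "\<forall>j>i. k j = l j" "l i' < m i'" "\<forall>j>i'. l j = m j"
  then show "\<exists>i. k i < m i \<and> (\<forall>j>i. k j = m j)"
    by (intro exI[of _ "max i i'"]) (cases i i' rule: linorder_cases; auto)
qed

lemma revlex_less_total:
  assumes "k \<noteq> l" "finite {i. k i \<noteq> 0}" "finite {i. l i \<noteq> 0}"
  shows "revlex_less k l \<or> revlex_less l k"
proof -
  let ?I = "{i. k i \<noteq> l i}"
  have fin: "finite ?I" by (rule finite_subset[OF _ finite_UnI[OF assms(2,3)]]) auto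
  moreover have ne: "?I \<noteq> {}" using assms(1) by auto
  ultimately have "Max ?I \<in> ?I" by (rule Max_in)
  moreover have "k j = l j" if "j > Max ?I" for j
    using that Max_ge[OF fin, of j] by auto
  ultimately show ?thesis unfolding revlex_less_def
    by (metis (mono_tags, lifting) linorder_neqE_linordered_idom mem_Collect_eq)
qed

instantiation expv :: linordered_ab_group_add
begin

lift_definition zero_expv :: expv is "\<lambda>_. 0" by simp

lift_definition plus_expv :: "expv \<Rightarrow> expv \<Rightarrow> expv" is "\<lambda>k l i. k i + l i"
  by (erule (1) finite_subset[OF _ finite_UnI, rotated]) auto

lift_definition uminus_expv :: "expv \<Rightarrow> expv" is "\<lambda>k i. - k i" by simp

lift_definition minus_expv :: "expv \<Rightarrow> expv \<Rightarrow> expv" is "\<lambda>k l i. k i - l i"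
  by (erule (1) finite_subset[OF _ finite_UnI, rotated]) auto

lift_definition less_expv :: "expv \<Rightarrow> expv \<Rightarrow> bool" is revlex_less .

lift_definition less_eq_expv :: "expv \<Rightarrow> expv \<Rightarrow> bool" is revlex_le .

instance
proof
  fix a b c :: expv
  show "a < b \<longleftrightarrow> a \<le> b \<and> \<not> b \<le> a"
    by transfer (metis revlex_le_def revlex_less_irrefl revlex_less_trans)
  show "a \<le> a" by transfer (simp add: revlex_le_def)
  show "a \<le> b \<Longrightarrow> b \<le> c \<Longrightarrow> a \<le> c"
    by transfer (metis revlex_le_def revlex_less_trans)
  show "a \<le> b \<Longrightarrow> b \<le> a \<Longrightarrow> a = b"
    by transfer (metis revlex_le_def revlex_less_irrefl revlex_less_trans)
  show "a \<le> b \<or> b \<le> a"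
    by transfer (metis revlex_le_def revlex_less_total)
  show "a \<le> b \<Longrightarrow> c + a \<le> c + b"
    by transfer (auto simp: revlex_le_def revlex_less_def)
qed (transfer; simp add: fun_eq_iff algebra_simps)+

end

lemma ev_0 [simp]: "ev 0 i = 0" by (simp add: zero_expv.rep_eq)
lemma ev_add [simp]: "ev (a + b) i = ev a i + ev b i" by (simp add: plus_expv.rep_eq)
lemma ev_uminus [simp]: "ev (- a) i = - ev a i" by (simp add: uminus_expv.rep_eq)
lemma ev_diff [simp]: "ev (a - b) i = ev a i - ev b i" by (simp add: minus_expv.rep_eq)
lemma ev_sum [simp]: "ev (sum f A) i = (\<Sum>a\<in>A. ev (f a) i)"
  by (induction A rule: infinite_finite_induct) auto

lift_definition unit_expv :: "nat \<Rightarrow> expv" is "\<lambda>i j. if j = i then 1 else 0"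
  by simp

lemma ev_unit_expv [simp]: "ev (unit_expv i) j = (if j = i then 1 else 0)"
  by (simp add: unit_expv.rep_eq)

lift_definition scale_expv :: "int \<Rightarrow> expv \<Rightarrow> expv" is "\<lambda>c k i. c * k i"
  by (erule finite_subset[rotated]) auto

lemma ev_scale_expv [simp]: "ev (scale_expv c k) i = c * ev k i"
  by (simp add: scale_expv.rep_eq)

lemma unit_expv_diff_pos: "a < b \<Longrightarrow> 0 < unit_expv b - unit_expv a"
  unfolding less_expv.rep_eq revlex_less_def by (rule exI[of _ b]) auto

lemma unit_leads_zpow:
  fixes f :: "(expv, 'a::idom) hahn"
  assumes D: "\<And>d. d \<in> D \<Longrightarrow> 0 < d" and f: "unit_leads D f f' b"
  shows "unit_leads D (zpow f f' k) (zpow f' f k) (scale_expv k b)"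
proof -
  have pow: "unit_leads D (f ^ m) (f' ^ m) (scale_expv (int m) b)"
    if "unit_leads D f f' b" for f f' :: "(expv, 'a) hahn" and b m
  proof -
    have "(\<Sum>i<m. b) = scale_expv (int m) b" by (rule expv_eqI) simp
    then show ?thesis using unit_leads_prod[OF D, where A = "{..<m}" and f = "\<lambda>_. f" and f' = "\<lambda>_. f'" and b = "\<lambda>_. b"] that by simp
  qed
  have "scale_expv (int (nat (- k))) (- b) = scale_expv k b" if "k < 0"
    by (rule expv_eqI) (use that in simp)
  then show ?thesis
    using pow[OF f, of "nat k"] pow[OF unit_leads_swap[OF f], of "nat (- k)"]
    by (auto simp: zpow_def not_le)
qed

section \<open>Partial derivatives and constant terms\<close>

text \<open>The derivation z_i d/dz_i. The factor z_i keeps exponents in place, so that every series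
  in the image has constant term 0.\<close>

lift_definition euler :: "nat \<Rightarrow> (expv, 'a::comm_ring_1) hahn \<Rightarrow> (expv, 'a) hahn"
  is "\<lambda>i f k. of_int (ev k i) * f k"
  by (erule wfp_on_subset) auto

lemma hcoeff_euler [simp]: "hcoeff (euler i f) k = of_int (ev k i) * hcoeff f k"
  by (simp add: euler.rep_eq)

lemma hsupp_euler: "hsupp (euler i f) \<subseteq> hsupp f"
  by (auto simp: hsupp_def)

lemma derivation_euler: "derivation (euler i :: (expv, 'a::comm_ring_1) hahn \<Rightarrow> _)"
proof
  fix f g :: "(expv, 'a) hahn"
  show "euler i (f + g) = euler i f + euler i g"
    by (rule hahn_eqI) (simp add: distrib_left)
  show "euler i (f * g) = euler i f * g + f * euler i g"
  proof (rule hahn_eqI)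
    fix m
    let ?K = "{k\<in>hsupp f. m - k \<in> hsupp g}"
    have "hcoeff (euler i f * g) m = (\<Sum>k\<in>?K. hcoeff (euler i f) k * hcoeff g (m - k))"
      by (rule hcoeff_mult_superset) (use hsupp_euler finite_hsupp_pairs in auto)
    moreover have "hcoeff (f * euler i g) m = (\<Sum>k\<in>?K. hcoeff f k * hcoeff (euler i g) (m - k))"
      by (rule hcoeff_mult_superset) (use hsupp_euler finite_hsupp_pairs in auto)
    ultimately show "hcoeff (euler i (f * g)) m = hcoeff (euler i f * g + f * euler i g) m"
      by (simp add: hcoeff_mult sum_distrib_left algebra_simps flip: sum.distrib)
  qed
qed

lemma euler_commute: "euler i (euler j f) = euler j (euler i f)"
  by (rule hahn_eqI) (simp add: mult_ac)

lemma euler_single: "euler i (single e c) = of_int (ev e i) * single e c"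
  by (rule hahn_eqI) (simp add: hcoeff_of_int_mult hcoeff_single)

abbreviation Zvar :: "nat \<Rightarrow> (expv, 'a::comm_ring_1) hahn" where
  "Zvar i \<equiv> single (unit_expv i) 1"

abbreviation Zinv :: "nat \<Rightarrow> (expv, 'a::comm_ring_1) hahn" where
  "Zinv i \<equiv> single (- unit_expv i) 1"

definition Zdiff_inv_less :: "nat \<Rightarrow> nat \<Rightarrow> (expv, 'a::comm_ring_1) hahn" where
  "Zdiff_inv_less a b = Zinv a * geometric (unit_expv b - unit_expv a)"

definition Zdiff_inv :: "nat \<Rightarrow> nat \<Rightarrow> (expv, 'a::comm_ring_1) hahn" where
  "Zdiff_inv a b = (if a < b then Zdiff_inv_less a b else - Zdiff_inv_less b a)"

lemma Zdiff_inv_swap: "a \<noteq> b \<Longrightarrow> Zdiff_inv b a = - Zdiff_inv a b"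
  by (auto simp: Zdiff_inv_def)

text \<open>
  \<open>Zdiff_inv a b\<close> is \<open>1 / (Zvar a - Zvar b)\<close>, expanded in powers of \<open>Zvar b / Zvar a\<close> if \<open>a < b\<close>;
  all these expansions are supported in translates of the cone generated by \<open>gens n\<close>.
\<close>

definition gens :: "nat \<Rightarrow> expv set" where
  "gens n = (\<lambda>(a, b). unit_expv b - unit_expv a) ` {(a, b). a \<in> {1..n} \<and> b \<in> {1..n} \<and> a < b}"

lemma gens_pos: "d \<in> gens n \<Longrightarrow> 0 < d"
  unfolding gens_def by clarify (rule unit_expv_diff_pos)

lemma finite_gens: "finite (gens n)"
proof -
  have "finite {(a, b). a \<in> {1..n} \<and> b \<in> {1..n} \<and> a < b}"
    by (rule finite_subset[of _ "{1..n} \<times> {1..n}"]) auto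
  then show ?thesis by (simp add: gens_def)
qed

lemma unit_leads_Zvar: "unit_leads D (Zvar i) (Zinv i :: (expv, 'a::idom) hahn) (unit_expv i)"
  by (rule unit_leads_single) simp

lemma Zvar_diff_factor:
  "Zvar a - Zvar b = Zvar a * (1 - single (unit_expv b - unit_expv a) 1 :: (expv, 'a::comm_ring_1) hahn)"
  by (simp add: right_diff_distrib single_mult_single)

lemma unit_leads_Zvar_diff:
  assumes "a \<in> {1..n}" "b \<in> {1..n}" "a < b"
  shows "unit_leads (gens n) (Zvar a - Zvar b) (Zdiff_inv a b :: (expv, 'a::idom) hahn) (unit_expv a)"
proof -
  have "unit_expv b - unit_expv a \<in> gens n" using assms by (auto simp: gens_def)
  from unit_leads_mult[OF gens_pos unit_leads_Zvar unit_leads_geometric[OF this unit_expv_diff_pos[OF assms(3)]]]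
  have "unit_leads (gens n) (Zvar a - Zvar b) (Zdiff_inv a b :: (expv, 'a) hahn) (unit_expv a + 0)"
    using assms(3) unfolding Zvar_diff_factor by (simp only: Zdiff_inv_def Zdiff_inv_less_def if_True)
  then show ?thesis by simp
qed

lemma Zdiff_inv:
  assumes "a \<noteq> b"
  shows "(Zvar a - Zvar b) * Zdiff_inv a b = (1 :: (expv, 'a::comm_ring_1) hahn)"
proof -
  have less: "(Zvar a - Zvar b) * Zdiff_inv a b = (1 :: (expv, 'a) hahn)" if "a < b" for a b
  proof -
    have "(Zvar a - Zvar b) * Zdiff_inv a b = (Zvar a * Zinv a) *
        ((1 - single (unit_expv b - unit_expv a) 1) * geometric (unit_expv b - unit_expv a) :: (expv, 'a) hahn)"
      using that unfolding Zvar_diff_factor by (simp add: Zdiff_inv_def Zdiff_inv_less_def mult_ac)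
    then show ?thesis
      using geometric[OF unit_expv_diff_pos[OF that]] by (simp add: single_mult_single single_0_1)
  qed
  show ?thesis
  proof (cases "a < b")
    case True
    then show ?thesis by (rule less)
  next
    case False
    have "(Zvar a - Zvar b) * Zdiff_inv a b = (Zvar b - Zvar a) * (Zdiff_inv b a :: (expv, 'a) hahn)"
      using Zdiff_inv_swap[OF assms, where 'a = 'a] by (simp add: algebra_simps)
    with False assms less[of b a] show ?thesis by simp
  qed
qed

section \<open>The series u_j, their inverses and their logarithmic derivatives\<close>

definition pairs :: "nat set \<Rightarrow> (nat \<times> nat) set" where
  "pairs I = {(a, b). a \<in> I \<and> b \<in> I \<and> a < b}"

lemma finite_pairs: "finite I \<Longrightarrow> finite (pairs I)"
  by (rule finite_subset[of _ "I \<times> I"]) (auto simp: pairs_def)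

definition Useries :: "nat \<Rightarrow> int \<Rightarrow> nat \<Rightarrow> (expv, 'a::comm_ring_1) hahn" where
  "Useries n r j = (- 1) ^ (j - 1) * zpow (Zvar j) (Zinv j) r * (\<Prod>(a, b)\<in>pairs ({1..n} - {j}). Zvar a - Zvar b)"

definition Useries_inv :: "nat \<Rightarrow> int \<Rightarrow> nat \<Rightarrow> (expv, 'a::comm_ring_1) hahn" where
  "Useries_inv n r j = (- 1) ^ (j - 1) * zpow (Zinv j) (Zvar j) r * (\<Prod>(a, b)\<in>pairs ({1..n} - {j}). Zdiff_inv a b)"

text \<open>For a < b the initial term of z_a - z_b is z_a, whence one \<open>unit_expv a\<close>
  for each pair.\<close>

definition Useries_exp :: "nat \<Rightarrow> int \<Rightarrow> nat \<Rightarrow> expv" where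
  "Useries_exp n r j = scale_expv r (unit_expv j) + (\<Sum>(a, b)\<in>pairs ({1..n} - {j}). unit_expv a)"

lemma unit_leads_Useries: "unit_leads (gens n) (Useries n r j) (Useries_inv n r j :: (expv, 'a::idom) hahn) (Useries_exp n r j)"
proof -
  have "unit_leads (gens n) (- 1) (- 1 :: (expv, 'a) hahn) 0"
  proof -
    have "single 0 (- 1) = (- 1 :: (expv, 'a) hahn)" using single_0_of_int[of "- 1"] by simp
    then show ?thesis
      using leads_single[of "- 1 :: 'a" "gens n" 0] by (simp add: unit_leads_def)
  qed
  then have "unit_leads (gens n) ((- 1) ^ (j - 1)) ((- 1) ^ (j - 1) :: (expv, 'a) hahn) 0"
    using unit_leads_prod[OF gens_pos, where A = "{..<j - 1}" and f = "\<lambda>_. - 1" and f' = "\<lambda>_. - 1" and b = "\<lambda>_. 0"] by simp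
  moreover have "unit_leads (gens n) (\<Prod>(a, b)\<in>pairs ({1..n} - {j}). Zvar a - Zvar b)
      (\<Prod>(a, b)\<in>pairs ({1..n} - {j}). Zdiff_inv a b :: (expv, 'a) hahn) (\<Sum>(a, b)\<in>pairs ({1..n} - {j}). unit_expv a)"
    by (rule unit_leads_prod) (auto simp: pairs_def gens_pos intro!: unit_leads_Zvar_diff)
  ultimately have "unit_leads (gens n) (Useries n r j) (Useries_inv n r j :: (expv, 'a::idom) hahn)
     (0 + scale_expv r (unit_expv j) + (\<Sum>(a, b)\<in>pairs ({1..n} - {j}). unit_expv a))"
    unfolding Useries_def Useries_inv_def
    by (intro unit_leads_mult unit_leads_zpow unit_leads_Zvar gens_pos)
  then show ?thesis by (simp add: Useries_exp_def)
qed

lemma Useries_mult_inv: "Useries n r j * Useries_inv n r j = (1 :: (expv, 'a::idom) hahn)"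
  using unit_leads_Useries unfolding unit_leads_def by blast

lemma euler_Zvar: "euler i (Zvar j) = (if i = j then Zvar j else 0)"
  by (auto simp: euler_single)

lemma dlog_Useries:
  assumes i: "i \<in> {1..n}" and l: "l \<in> {1..n}"
  shows "euler i (Useries n r l) * Useries_inv n r l =
     (if i = l then of_int r else \<Sum>b\<in>{1..n} - {i, l}. Zvar i * Zdiff_inv i b :: (expv, 'a::idom) hahn)"
proof -
  interpret derivation "euler i :: (expv, 'a) hahn \<Rightarrow> _" by (rule derivation_euler)
  let ?P = "pairs ({1..n} - {l})"
  have sgn: "(- 1) ^ (l - 1) * (- 1) ^ (l - 1) = (1 :: (expv, 'a) hahn)"
    by (simp flip: power_mult_distrib)
  have ZZ: "Zvar l * Zinv l = (1 :: (expv, 'a) hahn)"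
    by (simp add: single_mult_single single_0_1)
  have zz: "zpow (Zvar l) (Zinv l) r * zpow (Zinv l) (Zvar l) r = (1 :: (expv, 'a) hahn)"
    by (rule zpow_mult_zpow[OF ZZ])
  have ww: "(\<Prod>(a, b)\<in>?P. Zvar a - Zvar b) * (\<Prod>(a, b)\<in>?P. Zdiff_inv a b) = (1 :: (expv, 'a) hahn)"
    unfolding prod.distrib[symmetric] by (rule prod.neutral) (auto simp: pairs_def Zdiff_inv)
  have neg: "euler i ((- 1) ^ m) = (0 :: (expv, 'a) hahn)" for m
    using of_int[of "(- 1) ^ m"] by simp
  have "euler i (Useries n r l) * Useries_inv n r l =
      of_int r * (euler i (Zvar l) * Zinv l) +
      (\<Sum>p\<in>?P. (case p of (a, b) \<Rightarrow> (euler i (Zvar a - Zvar b) * Zdiff_inv a b :: (expv, 'a) hahn)))"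
  proof -
    have sz: "(- 1) ^ (l - 1) * zpow (Zvar l) (Zinv l) r * ((- 1) ^ (l - 1) * zpow (Zinv l) (Zvar l) r) = (1 :: (expv, 'a) hahn)"
      using sgn zz by (metis (no_types, lifting) mult.assoc mult.left_commute mult_1)
    have "euler i (\<Prod>p\<in>?P. case p of (a, b) \<Rightarrow> Zvar a - Zvar b) * (\<Prod>p\<in>?P. case p of (a, b) \<Rightarrow> Zdiff_inv a b) =
        (\<Sum>p\<in>?P. euler i (case p of (a, b) \<Rightarrow> Zvar a - Zvar b) * (case p of (a, b) \<Rightarrow> (Zdiff_inv a b :: (expv, 'a) hahn)))"
      by (rule dlog_prod) (auto simp: pairs_def Zdiff_inv)
    with dlog_mult[OF sz ww] dlog_mult[OF sgn zz] show ?thesis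
      by (simp only: Useries_def Useries_inv_def neg dlog_zpow[OF ZZ] mult_zero_left add_0 case_prod_unfold)
  qed
  also have "(\<Sum>p\<in>?P. (case p of (a, b) \<Rightarrow> euler i (Zvar a - Zvar b) * Zdiff_inv a b)) =
      (if i = l then 0 else \<Sum>b\<in>{1..n} - {i, l}. Zvar i * Zdiff_inv i b :: (expv, 'a) hahn)"
  proof (cases "i = l")
    case True
    have "euler i (Zvar a - Zvar b) * Zdiff_inv a b = (0 :: (expv, 'a) hahn)" if "a \<noteq> l" "b \<noteq> l" for a b
      using that True unfolding diff euler_Zvar by simp
    then show ?thesis using True by (auto simp: pairs_def intro!: sum.neutral)
  next
    case False
    let ?S = "{1..n} - {i, l}"
    \<comment> \<open>Only pairs containing i survive. If b < i, the sign of the derivative of z_b -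
      z_i cancels that of its inverse, so every pair gives z_i / (z_i - z_b).\<close>
    let ?f = "\<lambda>b. if i < b then (i, b) else (b, i)"
    have "(\<Sum>p\<in>?P. (case p of (a, b) \<Rightarrow> euler i (Zvar a - Zvar b) * Zdiff_inv a b)) =
        (\<Sum>p\<in>?f ` ?S. (case p of (a, b) \<Rightarrow> (euler i (Zvar a - Zvar b) * Zdiff_inv a b :: (expv, 'a) hahn)))"
    proof (rule sum.mono_neutral_right)
      show "?f ` ?S \<subseteq> ?P" using i False by (auto simp: pairs_def)
      show "\<forall>p\<in>?P - ?f ` ?S. (case p of (a, b) \<Rightarrow> euler i (Zvar a - Zvar b) * Zdiff_inv a b) = (0 :: (expv, 'a) hahn)"
      proof clarify
        fix a b assume ab: "(a, b) \<in> ?P" "(a, b) \<notin> ?f ` ?S"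
        have "a \<noteq> i" using ab image_eqI[of "(a, b)" ?f b ?S] by (auto simp: pairs_def)
        moreover have "b \<noteq> i" using ab image_eqI[of "(a, b)" ?f a ?S] by (auto simp: pairs_def)
        ultimately show "euler i (Zvar a - Zvar b) * Zdiff_inv a b = (0 :: (expv, 'a) hahn)"
          by (simp add: diff euler_Zvar)
      qed
    qed (simp add: finite_pairs)
    also have "\<dots> = (\<Sum>b\<in>?S. (case ?f b of (a, b) \<Rightarrow> (euler i (Zvar a - Zvar b) * Zdiff_inv a b :: (expv, 'a) hahn)))"
      by (rule sum.reindex_cong[of ?f]) (auto simp: inj_on_def split: if_splits)
    also have "\<dots> = (\<Sum>b\<in>?S. Zvar i * Zdiff_inv i b :: (expv, 'a) hahn)"
    proof (intro sum.cong refl)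
      fix b assume "b \<in> ?S"
      then show "(case ?f b of (a, b) \<Rightarrow> euler i (Zvar a - Zvar b) * Zdiff_inv a b) = (Zvar i * Zdiff_inv i b :: (expv, 'a) hahn)"
        using Zdiff_inv_swap[of i b, where 'a = 'a] by (auto simp: diff euler_Zvar)
    qed
    finally show ?thesis using False by simp
  qed
  finally show ?thesis by (simp add: euler_Zvar ZZ)
qed


lemma distinct_units_Zvar:
  "distinct_units n (\<lambda>i. Zvar (Suc i)) (\<lambda>i. Zinv (Suc i)) (\<lambda>i b. Zdiff_inv (Suc i) (Suc b))
     (single 0 (1 / 2) :: (expv, 'a::field_char_0) hahn)"
proof
  have "single 0 2 * single 0 (1 / 2) = (1 :: (expv, 'a) hahn)"
    by (simp add: single_mult_single single_0_1)
  moreover have "single 0 2 = (2 :: (expv, 'a) hahn)"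
    using single_0_of_int[of 2] by simp
  ultimately show "2 * single 0 (1 / 2) = (1 :: (expv, 'a) hahn)" by simp
qed (auto simp: Zdiff_inv single_mult_single single_0_1)

section \<open>Constant terms of the monomials in the u_j\<close>

definition Umonomial :: "nat \<Rightarrow> int \<Rightarrow> expo \<Rightarrow> (expv, 'a::comm_ring_1) hahn" where
  "Umonomial n r k = (\<Prod>l\<in>{1..n}. zpow (Useries n r l) (Useries_inv n r l) (k l))"

theorem const_term_Umonomial:
  assumes n: "n \<ge> 1" and r: "r \<notin> {0..int n - 2}" "r \<noteq> - int ((n - 1) choose 2)"
    and j: "j \<in> {1..n}" "k j \<noteq> 0"
  shows "hcoeff (Umonomial n r k :: (expv, 'a::field_char_0) hahn) 0 = 0"
proof -
  interpret distinct_units n "\<lambda>i. Zvar (Suc i)" "\<lambda>i. Zinv (Suc i)" "\<lambda>i b. Zdiff_inv (Suc i) (Suc b)"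
    "single 0 (1 / 2) :: (expv, 'a) hahn"
    by (rule distinct_units_Zvar)
  define D where "D i = (euler (Suc i) :: (expv, 'a) hahn \<Rightarrow> _)" for i
  define M where "M i l = (D i (Useries n r (Suc l)) * Useries_inv n r (Suc l) :: (expv, 'a) hahn)" for i l
  have D: "derivation (D i)" for i unfolding D_def by (rule derivation_euler)
  have M: "M i l = log_jacobian r i l" if "i < n" "l < n" for i l
  proof -
    have "(\<Sum>b\<in>{1..n} - {Suc i, Suc l}. Zvar (Suc i) * Zdiff_inv (Suc i) b) =
        (\<Sum>b\<in>{..<n} - {i, l}. Zvar (Suc i) * Zdiff_inv (Suc i) (Suc b) :: (expv, 'a) hahn)"
      by (rule sum.reindex_bij_witness[of _ Suc "\<lambda>b. b - 1"]) auto
    then show ?thesis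
      using that by (simp add: M_def D_def dlog_Useries log_jacobian_def)
  qed
  define P where "P = (\<Prod>t<n. if t = 0 then r else if t = 1 then r + int ((n - 1) choose 2) else r + int t - int n)"
  \<comment> \<open>The zeros n - t with 2 \<le> t < n are 1, ..., n - 2. For n = 1 the excluded
    interval is empty, and \<open>r \<noteq> 0\<close> comes from the condition on the binomial
    coefficient, which is then 0.\<close>
  have "(if t = 0 then r else if t = 1 then r + int ((n - 1) choose 2) else r + int t - int n) \<noteq> 0"
    if "t < n" for t
    using that r by (cases "n = 1") auto
  then have "P \<noteq> 0" unfolding P_def by (subst prod_zero_iff) auto
  have det: "det (mat n n (\<lambda>(i, l). M i l)) = of_int P"
  proof -
    have "mat n n (\<lambda>(i, l). M i l) = mat n n (\<lambda>(i, l). log_jacobian r i l)"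
      by (rule eq_matI) (auto simp: M)
    then show ?thesis unfolding P_def by (simp only: det_log_jacobian)
  qed
  have "of_int P * single 0 (inverse (of_int P)) = (1 :: (expv, 'a) hahn)" (is "_ * ?c = _")
    unfolding single_0_of_int[symmetric] using \<open>P \<noteq> 0\<close> by (simp add: single_mult_single single_0_1)
  then have unit: "det (mat n n (\<lambda>(i, l). M i l)) * ?c = 1" by (simp only: det)
  have closed: "D i (M m l) = D m (M i l)" for i m l
    using dlog_closed[OF D D, of i m "Useries n r (Suc l)" "Useries_inv n r (Suc l)"]
    by (simp add: M_def D_def euler_commute[of "Suc i"] Useries_mult_inv)
  have const: "D i (det (mat n n (\<lambda>(i, l). M i l))) = 0" for i
    unfolding det by (rule derivation.of_int[OF D])
  obtain B where B: "\<And>j l. j < n \<Longrightarrow> l < n \<Longrightarrow> (\<Sum>i<n. B j i * M i l) = of_bool (j = l)"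
    and div: "\<And>j. j < n \<Longrightarrow> (\<Sum>i<n. D i (B j i)) = 0"
    by (rule inverse_jacobian_divergence_free[where D = D and M = M and n = n, OF D closed const unit]) blast
  let ?F = "Umonomial n r k :: (expv, 'a) hahn"
  have F: "D i ?F = ?F * (\<Sum>l<n. of_int (k (Suc l)) * M i l)" for i
  proof -
    interpret derivation "D i" by (rule D)
    let ?f = "\<lambda>l. zpow (Useries n r l) (Useries_inv n r l) (k l) :: (expv, 'a) hahn"
      and ?f' = "\<lambda>l. zpow (Useries_inv n r l) (Useries n r l) (k l) :: (expv, 'a) hahn"
    have ff: "?f l * ?f' l = 1" for l by (rule zpow_mult_zpow[OF Useries_mult_inv])
    have "D i ?F * prod ?f' {1..n} = (\<Sum>l\<in>{1..n}. D i (?f l) * ?f' l)"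
      unfolding Umonomial_def by (rule dlog_prod[OF ff])
    also have "\<dots> = (\<Sum>l\<in>{1..n}. of_int (k l) * (D i (Useries n r l) * Useries_inv n r l))"
      by (simp only: dlog_zpow[OF Useries_mult_inv])
    also have "\<dots> = (\<Sum>l<n. of_int (k (Suc l)) * M i l)"
      unfolding M_def by (rule sum.reindex_bij_witness[of _ Suc "\<lambda>l. l - 1"]) auto
    finally have "?F * (\<Sum>l<n. of_int (k (Suc l)) * M i l) = D i ?F * (?F * prod ?f' {1..n})"
      by (simp add: mult_ac)
    also have "?F * prod ?f' {1..n} = 1"
      unfolding Umonomial_def prod.distrib[symmetric] by (rule prod.neutral) (use ff in auto)
    finally show ?thesis by simp
  qed
  \<comment> \<open>Variable j belongs to row j - 1 of the matrices, which are indexed from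
    0.\<close>
  have "of_int (k (Suc (j - 1))) * ?F = (\<Sum>i<n. D i (B (j - 1) i * ?F))"
    by (rule logarithmic_field_is_divergence[where k = "\<lambda>l. k (Suc l)" and n = n and D = D and M = M and B = B])
       (use D B div F j in auto)
  then have "hcoeff (of_int (k j) * ?F) 0 = hcoeff (\<Sum>i<n. D i (B (j - 1) i * ?F)) 0"
    using j by simp
  \<comment> \<open>The right side has constant term 0, and \<open>of_int (k j)\<close> is nonzero
    in characteristic 0.\<close>
  then show ?thesis using j(2) by (simp add: hcoeff_of_int_mult D_def)
qed

section \<open>Embedding into the ring of iterated Laurent series\<close>

text \<open>Antisymmetry of the pulled-back order is injectivity of \<open>g\<close>. Applied to
  \<rho>, it separates the images of distinct exponents of a series in
  \<open>series_set n \<rho>\<close>.\<close>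

lemma well_order_on_iff_wfp_on:
  fixes g :: "'b \<Rightarrow> 'c::linorder"
  shows "well_order_on A {(k, l). k \<in> A \<and> l \<in> A \<and> g k \<le> g l} \<longleftrightarrow> inj_on g A \<and> wfp_on (g ` A) (<)"
    (is "well_order_on A ?r \<longleftrightarrow> _")
proof
  assume wo: "well_order_on A ?r"
  then have "antisym ?r" and wf: "wf (?r - Id)" by (auto simp: order_on_defs)
  from \<open>antisym ?r\<close> have inj: "inj_on g A" by (auto simp: inj_on_def antisym_def)
  have "wfp_on (g ` A) (<)"
    unfolding wfp_on_iff_ex_minimal
  proof (intro allI impI)
    fix B assume B: "B \<subseteq> g ` A" "B \<noteq> {}"
    then obtain k0 where "k0 \<in> {k\<in>A. g k \<in> B}" by auto
    with wf obtain k where k: "k \<in> {k\<in>A. g k \<in> B}" "\<And>l. (l, k) \<in> ?r - Id \<Longrightarrow> l \<notin> {k\<in>A. g k \<in> B}"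
      unfolding wf_eq_minimal by meson
    have "y \<notin> B" if "y < g k" for y
    proof
      assume "y \<in> B"
      with B obtain l where "l \<in> A" "y = g l" by auto
      moreover from this that have "g l \<le> g k" "l \<noteq> k" by auto
      ultimately show False using k(1) k(2)[of l] \<open>y \<in> B\<close> by simp
    qed
    with k(1) show "\<exists>z\<in>B. \<forall>y<z. y \<notin> B" by auto
  qed
  with inj show "inj_on g A \<and> wfp_on (g ` A) (<)" ..
next
  assume *: "inj_on g A \<and> wfp_on (g ` A) (<)"
  have "wf (?r - Id)"
    unfolding wf_eq_minimal
  proof (intro allI impI)
    fix x Q assume x: "x \<in> (Q :: 'b set)"
    show "\<exists>z\<in>Q. \<forall>y. (y, z) \<in> ?r - Id \<longrightarrow> y \<notin> Q"
    proof (cases "Q \<inter> A = {}")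
      case True
      with x show ?thesis by auto
    next
      case False
      then have "g ` (Q \<inter> A) \<noteq> {}" "g ` (Q \<inter> A) \<subseteq> g ` A" by auto
      with * obtain z where z: "z \<in> g ` (Q \<inter> A)" "\<forall>y<z. y \<notin> g ` (Q \<inter> A)"
        unfolding wfp_on_iff_ex_minimal by meson
      then obtain k where k: "k \<in> Q" "k \<in> A" "z = g k" by auto
      have "l \<notin> Q" if l: "(l, k) \<in> ?r - Id" for l
      proof
        assume "l \<in> Q"
        then have "g l \<in> g ` (Q \<inter> A)" using l by auto
        moreover have "g l \<noteq> g k" using l * by (auto dest: inj_onD)
        then have "g l < z" using l k(3) by auto
        ultimately show False using z(2) by blast
      qed
      with k show ?thesis by blast
    qed
  qed
  moreover have "antisym ?r" using * by (auto simp: antisym_def dest: inj_onD)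
  ultimately show "well_order_on A ?r"
    by (auto simp: order_on_defs refl_on_def trans_def total_on_def)
qed

text \<open>An \<open>fseries\<close> also has coefficients at vectors of infinite support; these
  receive the default 0.\<close>

definition emb :: "(expv, 'a::zero) hahn \<Rightarrow> 'a fseries" where
  "emb h k = (if finite {i. k i \<noteq> 0} then hcoeff h (Abs_expv k) else 0)"

lemma emb_ev [simp]: "emb h (ev e) = hcoeff h e"
  by (simp add: emb_def finite_ev ev_inverse)

lemma emb_infinite: "infinite {i. k i \<noteq> 0} \<Longrightarrow> emb h k = 0"
  by (simp add: emb_def)

lemma expo_cases:
  obtains e where "k = ev e" | "infinite {i. k i \<noteq> 0}"
  using Abs_expv_inverse[of k] by (metis mem_Collect_eq)

lemma emb_eqI:
  assumes "\<And>e. f (ev e) = hcoeff h e" "\<And>k. infinite {i. k i \<noteq> 0} \<Longrightarrow> f k = 0"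
  shows "f = emb h"
proof
  fix k
  show "f k = emb h k"
    by (cases k rule: expo_cases) (simp_all add: assms emb_infinite)
qed

lemma supp_emb: "supp (emb h) = ev ` hsupp h"
proof -
  have "k \<in> supp (emb h) \<longleftrightarrow> k \<in> ev ` hsupp h" for k
    by (cases k rule: expo_cases)
       (auto simp: supp_def hsupp_def emb_infinite finite_ev ev_inject)
  then show ?thesis by blast
qed

definition expvs :: "nat \<Rightarrow> expv set" where
  "expvs n = {e. ev e \<in> expos n}"

definition hahn_vars :: "nat \<Rightarrow> (expv, 'a::zero) hahn set" where
  "hahn_vars n = {h. hsupp h \<subseteq> expvs n}"

lemma finite_expos: "k \<in> expos n \<Longrightarrow> finite {i. k i \<noteq> 0}"
  by (rule finite_subset[of _ "{1..n}"]) (auto simp: expos_def)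

lemma expvs_closed:
  "0 \<in> expvs n" "a \<in> expvs n \<Longrightarrow> b \<in> expvs n \<Longrightarrow> a + b \<in> expvs n"
  "a \<in> expvs n \<Longrightarrow> scale_expv c a \<in> expvs n"
  "i \<in> {1..n} \<Longrightarrow> unit_expv i \<in> expvs n"
  by (auto simp: expvs_def expos_def)

lemma expvs_sum: "(\<And>a. a \<in> A \<Longrightarrow> f a \<in> expvs n) \<Longrightarrow> sum f A \<in> expvs n"
  by (auto simp: expvs_def expos_def intro!: sum.neutral)

lemma mcone_gens_subset: "mcone (gens n) \<subseteq> expvs n"
proof
  fix x assume "x \<in> mcone (gens n)"
  then show "x \<in> expvs n"
    by induction (auto simp: expvs_def expos_def gens_def)
qed

lemma leads_hahn_vars:
  assumes "leads (gens n) h b" "b \<in> expvs n"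
  shows "h \<in> hahn_vars n"
proof -
  have "k \<in> expvs n" if "k \<in> hsupp h" for k
  proof -
    have "k - b \<in> expvs n"
      using that assms(1) mcone_gens_subset by (auto simp: leads_def)
    from expvs_closed(2)[OF this assms(2)] show ?thesis by simp
  qed
  then show ?thesis by (auto simp: hahn_vars_def)
qed

text \<open>On \<open>expos n\<close> the reverse lexicographic order is that of
  \<open>expv\<close>, so the condition on the support is the one that defines Hahn series.\<close>

lemma carrier_ils: "carrier (ils n :: 'a::field fseries ring) = emb ` hahn_vars n"
proof (rule Set.set_eqI)
  fix f :: "'a fseries"
  have le: "revlex_le k l \<longleftrightarrow> Abs_expv k \<le> Abs_expv l" if "k \<in> expos n" "l \<in> expos n" for k l
    using that[THEN finite_expos] by (simp add: less_eq_expv.rep_eq Abs_expv_inverse)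
  have "f \<in> carrier (ils n) \<longleftrightarrow> supp f \<subseteq> expos n \<and>
      well_order_on (supp f) {(k, l). k \<in> supp f \<and> l \<in> supp f \<and> revlex_le k l}"
    by (simp add: ils_def series_set_def)
  also have "\<dots> \<longleftrightarrow> supp f \<subseteq> expos n \<and>
      well_order_on (supp f) {(k, l). k \<in> supp f \<and> l \<in> supp f \<and> Abs_expv k \<le> Abs_expv l}"
    by (intro conj_cong refl arg_cong2[of _ _ _ _ well_order_on]) (auto simp: le subset_iff)
  also have "\<dots> \<longleftrightarrow> supp f \<subseteq> expos n \<and> wfp_on (Abs_expv ` supp f) (<)"
  proof -
    have "inj_on Abs_expv (expos n)"
      by (rule inj_onI) (simp add: Abs_expv_inject finite_expos)
    then show ?thesis
      unfolding well_order_on_iff_wfp_on using inj_on_subset by blast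
  qed
  also have "\<dots> \<longleftrightarrow> f \<in> emb ` hahn_vars n"
  proof
    assume f: "supp f \<subseteq> expos n \<and> wfp_on (Abs_expv ` supp f) (<)"
    have "{e. f (ev e) \<noteq> 0} \<subseteq> Abs_expv ` supp f"
    proof
      fix e assume "e \<in> {e. f (ev e) \<noteq> 0}"
      then show "e \<in> Abs_expv ` supp f"
        by (intro image_eqI[of _ _ "ev e"]) (auto simp: supp_def ev_inverse)
    qed
    with f have wf: "wfp_on {e. f (ev e) \<noteq> 0} (<)" by (blast intro: wfp_on_subset)
    have h: "hcoeff (Abs_hahn (\<lambda>e. f (ev e))) e = f (ev e)" for e
      using wf by (simp add: Abs_hahn_inverse)
    have "f = emb (Abs_hahn (\<lambda>e. f (ev e)))"
      by (rule emb_eqI) (use f finite_expos in \<open>auto simp: h supp_def subset_iff\<close>)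
    moreover have "Abs_hahn (\<lambda>e. f (ev e)) \<in> hahn_vars n"
      using f by (auto simp: hahn_vars_def expvs_def hsupp_def h supp_def)
    ultimately show "f \<in> emb ` hahn_vars n" by blast
  next
    assume "f \<in> emb ` hahn_vars n"
    then obtain h where h: "f = emb h" "hsupp h \<subseteq> expvs n" by (auto simp: hahn_vars_def)
    have "Abs_expv ` supp f = hsupp h" by (simp add: h supp_emb image_image ev_inverse)
    then show "supp f \<subseteq> expos n \<and> wfp_on (Abs_expv ` supp f) (<)"
      using h(2) by (auto simp: wfp_on_hsupp h(1) supp_emb expvs_def)
  qed
  finally show "f \<in> carrier (ils n) \<longleftrightarrow> f \<in> emb ` hahn_vars n" .
qed

lemma hahn_vars_closed:
  "0 \<in> hahn_vars n" "(1 :: (expv, 'a::comm_ring_1) hahn) \<in> hahn_vars n"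
  "(f :: (expv, 'a) hahn) \<in> hahn_vars n \<Longrightarrow> g \<in> hahn_vars n \<Longrightarrow> f + g \<in> hahn_vars n"
  "f \<in> hahn_vars n \<Longrightarrow> - f \<in> hahn_vars n"
  "f \<in> hahn_vars n \<Longrightarrow> g \<in> hahn_vars n \<Longrightarrow> f * g \<in> hahn_vars n"
proof -
  show "(1 :: (expv, 'a) hahn) \<in> hahn_vars n"
    using expvs_closed(1) by (auto simp: hahn_vars_def hsupp_def hcoeff_1 split: if_splits)
  show "f \<in> hahn_vars n \<Longrightarrow> g \<in> hahn_vars n \<Longrightarrow> f * g \<in> hahn_vars n"
    unfolding hahn_vars_def using hsupp_mult[of f g] expvs_closed(2) by fastforce
  show "(f :: (expv, 'a) hahn) \<in> hahn_vars n \<Longrightarrow> g \<in> hahn_vars n \<Longrightarrow> f + g \<in> hahn_vars n"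
    by (auto simp: hahn_vars_def hsupp_def subset_iff) (metis add.right_neutral)
qed (auto simp: hahn_vars_def hsupp_def)

lemma hahn_vars_prod:
  fixes f :: "'i \<Rightarrow> (expv, 'a::comm_ring_1) hahn"
  shows "(\<And>a. a \<in> A \<Longrightarrow> f a \<in> hahn_vars n) \<Longrightarrow> prod f A \<in> hahn_vars n"
  by (induction A rule: infinite_finite_induct) (auto intro: hahn_vars_closed)

lemma emb_zero: "\<zero>\<^bsub>ils n\<^esub> = emb 0"
  by (rule emb_eqI) (auto simp: ils_def)

lemma ev_eq_0_iff: "ev e = (\<lambda>_. 0) \<longleftrightarrow> e = 0"
  by (simp add: ev_inject[symmetric] zero_expv.rep_eq)

lemma emb_one: "\<one>\<^bsub>ils n\<^esub> = emb 1"
  by (rule emb_eqI) (auto simp: ils_def hcoeff_1 ev_eq_0_iff)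

lemma emb_add: "emb f \<oplus>\<^bsub>ils n\<^esub> emb g = emb (f + g :: (expv, 'a::field) hahn)"
  by (rule emb_eqI) (auto simp: ils_def emb_infinite)

lemma emb_mult: "emb f \<otimes>\<^bsub>ils n\<^esub> emb g = emb (f * g :: (expv, 'a::field) hahn)"
proof (rule emb_eqI)
  fix m
  have m: "(\<lambda>i. ev m i - ev k i) = ev (m - k)" for k by (simp add: fun_eq_iff)
  have "(emb f \<otimes>\<^bsub>ils n\<^esub> emb g) (ev m) =
      (\<Sum>k | emb f k \<noteq> 0 \<and> emb g (\<lambda>i. ev m i - k i) \<noteq> 0. emb f k * emb g (\<lambda>i. ev m i - k i))"
    by (simp add: ils_def)
  also have "\<dots> = (\<Sum>k\<in>{k\<in>hsupp f. m - k \<in> hsupp g}. hcoeff f k * hcoeff g (m - k))"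
  proof (rule sum.reindex_bij_witness[of _ ev Abs_expv])
    fix k assume k: "k \<in> {k. emb f k \<noteq> 0 \<and> emb g (\<lambda>i. ev m i - k i) \<noteq> 0}"
    then obtain e where e: "k = ev e"
      by (cases k rule: expo_cases) (auto simp: emb_infinite)
    with k show "ev (Abs_expv k) = k" "Abs_expv k \<in> {k\<in>hsupp f. m - k \<in> hsupp g}"
      "hcoeff f (Abs_expv k) * hcoeff g (m - Abs_expv k) = emb f k * emb g (\<lambda>i. ev m i - k i)"
      by (auto simp: ev_inverse m hsupp_def)
  qed (auto simp: hsupp_def m ev_inverse)
  finally show "(emb f \<otimes>\<^bsub>ils n\<^esub> emb g) (ev m) = hcoeff (f * g) m"
    by (simp add: hcoeff_mult)
next
  fix m :: expo assume m: "infinite {i. m i \<noteq> 0}"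
  \<comment> \<open>A vector of infinite support is not the sum of two vectors of finite
    support.\<close>
  have "emb f k = 0 \<or> emb g (\<lambda>i. m i - k i) = 0" for k
  proof (rule ccontr)
    assume "\<not> ?thesis"
    then have "finite {i. k i \<noteq> 0}" "finite {i. m i - k i \<noteq> 0}" by (auto simp: emb_def split: if_splits)
    then have "finite {i. m i \<noteq> 0}"
      by (rule finite_subset[OF _ finite_UnI, rotated]) auto
    with m show False by simp
  qed
  then show "(emb f \<otimes>\<^bsub>ils n\<^esub> emb g) m = 0"
    by (auto simp: ils_def intro!: sum.neutral)
qed

lemma cring_ils: "cring (ils n :: 'a::field fseries ring)"
proof (rule cringI)
  show "abelian_group (ils n :: 'a fseries ring)"
  proof (rule abelian_groupI)
    fix x :: "'a fseries" assume "x \<in> carrier (ils n)"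
    then obtain f where "x = emb f" "f \<in> hahn_vars n" by (auto simp: carrier_ils)
    then show "\<exists>y\<in>carrier (ils n). y \<oplus>\<^bsub>ils n\<^esub> x = \<zero>\<^bsub>ils n\<^esub>"
      by (intro bexI[of _ "emb (- f)"]) (auto simp: carrier_ils emb_add emb_zero hahn_vars_closed)
  qed (auto simp: carrier_ils emb_add emb_zero add_ac intro!: imageI hahn_vars_closed)
  show "comm_monoid (ils n :: 'a fseries ring)"
    by (rule comm_monoidI)
       (auto simp: carrier_ils emb_mult emb_one mult_ac intro!: imageI hahn_vars_closed)
qed (auto simp: carrier_ils emb_mult emb_add distrib_right)

lemma emb_minus:
  assumes "f \<in> hahn_vars n" "g \<in> hahn_vars n"
  shows "emb f \<ominus>\<^bsub>ils n\<^esub> emb g = emb (f - g :: (expv, 'a::field) hahn)"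
    and "\<ominus>\<^bsub>ils n\<^esub> emb g = emb (- g)"
proof -
  interpret cring "ils n :: 'a fseries ring" by (rule cring_ils)
  show *: "\<ominus>\<^bsub>ils n\<^esub> emb g = emb (- g)"
    by (rule minus_equality) (use assms in \<open>auto simp: carrier_ils emb_add emb_zero hahn_vars_closed\<close>)
  show "emb f \<ominus>\<^bsub>ils n\<^esub> emb g = emb (f - g)"
    by (simp add: a_minus_def * emb_add)
qed

lemma emb_prod:
  fixes f :: "'i \<Rightarrow> (expv, 'a::field) hahn"
  assumes "finite A" "\<And>a. a \<in> A \<Longrightarrow> f a \<in> hahn_vars n" "\<And>a. a \<in> A \<Longrightarrow> F a = emb (f a)"
  shows "finprod (ils n) F A = emb (prod f A)"
proof -
  interpret cring "ils n :: 'a fseries ring" by (rule cring_ils)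
  show ?thesis using assms
  proof (induction A rule: finite_induct)
    case empty
    then show ?case by (simp add: emb_one)
  next
    case (insert x A)
    have "F a \<in> carrier (ils n)" if "a \<in> insert x A" for a
      using insert.prems that by (auto simp: carrier_ils)
    then have "finprod (ils n) F (insert x A) = F x \<otimes>\<^bsub>ils n\<^esub> finprod (ils n) F A"
      using insert.hyps by (intro finprod_insert) auto
    then show ?case using insert by (simp add: emb_mult)
  qed
qed

lemma emb_power: "emb f [^]\<^bsub>ils n\<^esub> (m::nat) = emb (f ^ m :: (expv, 'a::field) hahn)"
  by (induction m) (simp_all add: emb_one emb_mult mult.commute)

lemma emb_zpow:
  assumes "f * f' = 1" "f \<in> hahn_vars n" "f' \<in> hahn_vars n"
  shows "emb f [^]\<^bsub>ils n\<^esub> (k::int) = emb (zpow f f' k :: (expv, 'a::field) hahn)"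
proof -
  interpret cring "ils n :: 'a fseries ring" by (rule cring_ils)
  have pow: "emb g \<in> carrier (ils n)" if "g \<in> hahn_vars n" for g :: "(expv, 'a) hahn"
    using that by (simp add: carrier_ils)
  have "f ^ m * f' ^ m = 1" for m using assms(1) by (simp flip: power_mult_distrib)
  moreover have "g ^ m \<in> hahn_vars n" if "g \<in> hahn_vars n" for g :: "(expv, 'a) hahn" and m
    using that by (induction m) (auto intro: hahn_vars_closed)
  \<comment> \<open>Negative powers in \<open>ils n\<close> are inverses of natural powers, and an
    inverse in the carrier is unique.\<close>
  ultimately have "inv\<^bsub>ils n\<^esub> (emb (f ^ m)) = emb (f' ^ m)" for m
    using assms by (intro comm_inv_char) (auto simp: pow emb_mult emb_one)
  then show ?thesis
    by (auto simp: int_pow_def2 zpow_def emb_power)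
qed

lemma emb_Zvar: "zvar i = emb (Zvar i :: (expv, 'a::field) hahn)"
proof (rule emb_eqI)
  fix e
  have "ev e = (\<lambda>j. if j = i then 1 else 0) \<longleftrightarrow> e = unit_expv i"
    by (simp add: ev_inject[symmetric] unit_expv.rep_eq)
  then show "zvar i (ev e) = hcoeff (Zvar i :: (expv, 'a) hahn) e"
    by (simp add: zvar_def hcoeff_single)
next
  fix k :: expo assume "infinite {j. k j \<noteq> 0}"
  then have "k \<noteq> (\<lambda>j. if j = i then 1 else 0)" using finite_ev[of "unit_expv i"] by auto
  then show "zvar i k = (0 :: 'a)" by (simp add: zvar_def)
qed

lemma Zvar_hahn_vars: "i \<in> {1..n} \<Longrightarrow> Zvar i \<in> hahn_vars n" "i \<in> {1..n} \<Longrightarrow> Zinv i \<in> hahn_vars n"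
  using hsupp_single by (fastforce simp: hahn_vars_def expvs_def expos_def)+

lemma Useries_exp_expvs: "j \<in> {1..n} \<Longrightarrow> Useries_exp n r j \<in> expvs n"
  unfolding Useries_exp_def
  by (intro expvs_closed expvs_sum) (auto simp: pairs_def intro!: expvs_closed)

lemma Useries_hahn_vars:
  assumes "j \<in> {1..n}"
  shows "(Useries n r j :: (expv, 'a::idom) hahn) \<in> hahn_vars n" "(Useries_inv n r j :: (expv, 'a) hahn) \<in> hahn_vars n"
proof -
  have "- Useries_exp n r j = scale_expv (- 1) (Useries_exp n r j)" by (rule expv_eqI) simp
  then have "- Useries_exp n r j \<in> expvs n" using Useries_exp_expvs[OF assms] expvs_closed(3) by metis
  then show "(Useries_inv n r j :: (expv, 'a) hahn) \<in> hahn_vars n"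
    using unit_leads_Useries[of n r j, where 'a = 'a] unfolding unit_leads_def by (blast intro: leads_hahn_vars)
  show "(Useries n r j :: (expv, 'a) hahn) \<in> hahn_vars n"
    using unit_leads_Useries[of n r j, where 'a = 'a] Useries_exp_expvs[OF assms] unfolding unit_leads_def by (blast intro: leads_hahn_vars)
qed

lemma useries_eq_emb:
  assumes j: "j \<in> {1..n}"
  shows "useries n r j = emb (Useries n r j :: (expv, 'a::field) hahn)"
proof -
  let ?I = "{1..n} - {j}"
  have "Delta (ils n) zvar ?I = emb (\<Prod>(a, b)\<in>pairs ?I. Zvar a - Zvar b :: (expv, 'a) hahn)"
    unfolding Delta_def pairs_def[symmetric]
  proof (rule emb_prod)
    fix p assume "p \<in> pairs ?I"
    then obtain a b where p: "p = (a, b)" and Zs: "(Zvar a :: (expv, 'a) hahn) \<in> hahn_vars n" "(Zvar b :: (expv, 'a) hahn) \<in> hahn_vars n"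
      by (auto simp: pairs_def Zvar_hahn_vars)
    show "(case p of (a, b) \<Rightarrow> (Zvar a - Zvar b :: (expv, 'a) hahn)) \<in> hahn_vars n"
      using hahn_vars_closed(3)[OF Zs(1) hahn_vars_closed(4)[OF Zs(2)]] by (simp add: p)
    show "(case p of (a, b) \<Rightarrow> zvar a \<ominus>\<^bsub>ils n\<^esub> zvar b) = emb (case p of (a, b) \<Rightarrow> (Zvar a - Zvar b :: (expv, 'a) hahn))"
      using emb_minus(1)[OF Zs] by (simp add: p emb_Zvar)
  qed (simp add: finite_pairs)
  moreover have "zvar j [^]\<^bsub>ils n\<^esub> r = emb (zpow (Zvar j) (Zinv j) r :: (expv, 'a) hahn)"
    unfolding emb_Zvar using j
    by (intro emb_zpow Zvar_hahn_vars) (auto simp: single_mult_single single_0_1)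
  moreover have "\<ominus>\<^bsub>ils n\<^esub> \<one>\<^bsub>ils n\<^esub> = emb (- 1 :: (expv, 'a) hahn)"
    unfolding emb_one by (rule emb_minus) (auto intro: hahn_vars_closed)
  ultimately show ?thesis
    by (simp add: useries_def Useries_def emb_power emb_mult)
qed

lemma monomial_at_eq_emb:
  "monomial_at n (useries n r) k = emb (Umonomial n r k :: (expv, 'a::field) hahn)"
  unfolding monomial_at_def Umonomial_def
proof (rule emb_prod)
  fix l assume l: "l \<in> {1..n}"
  have hv: "zpow f f' c \<in> hahn_vars n" if "f \<in> hahn_vars n" "f' \<in> hahn_vars n"
    for f f' :: "(expv, 'a) hahn" and c
    using that hahn_vars_prod[of "{..<nat c}" "\<lambda>_. f" n] hahn_vars_prod[of "{..<nat (- c)}" "\<lambda>_. f'" n]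
    by (simp add: zpow_def)
  show "zpow (Useries n r l) (Useries_inv n r l :: (expv, 'a) hahn) (k l) \<in> hahn_vars n"
    by (intro hv Useries_hahn_vars l)
  show "useries n r l [^]\<^bsub>ils n\<^esub> k l = emb (zpow (Useries n r l) (Useries_inv n r l :: (expv, 'a) hahn) (k l))"
    unfolding useries_eq_emb[OF l] by (intro emb_zpow Useries_mult_inv Useries_hahn_vars l)
qed simp

section \<open>Initial exponents of the monomials and convergence\<close>

lemma initial_exp_emb:
  assumes "leads (gens n) h b"
  shows "initial_exp (emb h) = ev b"
  unfolding initial_exp_def
proof (rule the_equality)
  have min: "b \<le> k" if "k \<in> hsupp h" for k
    using mcone_nonneg[OF gens_pos, where x = "k - b"] assms that by (auto simp: leads_def)
  show *: "ev b \<in> supp (emb h) \<and> (\<forall>l\<in>supp (emb h). revlex_le (ev b) l)"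
    using assms min by (auto simp: leads_def supp_emb hsupp_def simp flip: less_eq_expv.rep_eq)
  fix k assume k: "k \<in> supp (emb h) \<and> (\<forall>l\<in>supp (emb h). revlex_le k l)"
  with * have "revlex_le k (ev b)" "revlex_le (ev b) k" by auto
  then show "k = ev b"
    unfolding revlex_le_def using revlex_less_irrefl revlex_less_trans by blast
qed

definition Umonomial_exp :: "nat \<Rightarrow> int \<Rightarrow> expo \<Rightarrow> expv" where
  "Umonomial_exp n r k = (\<Sum>l\<in>{1..n}. scale_expv (k l) (Useries_exp n r l))"

text \<open>The cone is the same for every \<open>k\<close>, negative entries included; this
  uniformity is what convergence rests on.\<close>

lemma leads_Umonomial:
  "leads (gens n) (Umonomial n r k :: (expv, 'a::idom) hahn) (Umonomial_exp n r k)"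
proof -
  have "unit_leads (gens n) (Umonomial n r k :: (expv, 'a) hahn)
      (\<Prod>l\<in>{1..n}. zpow (Useries_inv n r l) (Useries n r l) (k l)) (Umonomial_exp n r k)"
    unfolding Umonomial_def Umonomial_exp_def
    by (intro unit_leads_prod unit_leads_zpow unit_leads_Useries gens_pos)
  then show ?thesis by (simp add: unit_leads_def)
qed

lemma rho_eq_ev: "rho n (useries n r :: nat \<Rightarrow> 'a::field fseries) k = ev (Umonomial_exp n r k)"
proof
  fix j
  have "initial_exp (useries n r l :: 'a fseries) = ev (Useries_exp n r l)" if "l \<in> {1..n}" for l
    unfolding useries_eq_emb[OF that]
    by (rule initial_exp_emb) (use unit_leads_Useries in \<open>auto simp: unit_leads_def\<close>)
  then show "rho n (useries n r :: nat \<Rightarrow> 'a fseries) k j = ev (Umonomial_exp n r k) j"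
    by (simp add: rho_def Umonomial_exp_def)
qed

theorem eval_converges_useries:
  fixes \<Phi> :: "'a::field fseries"
  assumes \<Phi>: "\<Phi> \<in> series_set n (rho n (useries n r :: nat \<Rightarrow> 'a fseries))"
  shows "eval_converges n \<Phi> (useries n r)"
proof -
  let ?R = "Umonomial_exp n r" and ?u = "useries n r :: nat \<Rightarrow> 'a fseries"
  let ?h = "\<lambda>k. Umonomial n r k :: (expv, 'a) hahn"
  have "well_order_on (supp \<Phi>) {(k, l). k \<in> supp \<Phi> \<and> l \<in> supp \<Phi> \<and> ?R k \<le> ?R l}"
    using \<Phi> by (simp add: series_set_def rho_eq_ev less_eq_expv.rep_eq)
  then have inj: "inj_on ?R (supp \<Phi>)" and wf: "wfp_on (?R ` supp \<Phi>) (<)"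
    unfolding well_order_on_iff_wfp_on by auto
  have wfC: "wfp_on (mcone (gens n)) (<)"
    by (rule wfp_on_mcone[OF finite_gens gens_pos])
  have contr: "k \<in> supp \<Phi>" "e - ?R k \<in> mcone (gens n)"
    if "k \<in> contributions n \<Phi> ?u (ev e)" for k e
  proof -
    have "\<Phi> k \<noteq> 0" "e \<in> hsupp (?h k)"
      using that by (auto simp: contributions_def monomial_at_eq_emb hsupp_def)
    with leads_Umonomial[of n r k, where 'a = 'a]
    show "k \<in> supp \<Phi>" "e - ?R k \<in> mcone (gens n)"
      by (auto simp: supp_def leads_def)
  qed
  have contr_inf: "contributions n \<Phi> ?u m = {}" if "infinite {i. m i \<noteq> 0}" for m
    using that by (simp add: contributions_def monomial_at_eq_emb emb_infinite)
  have fin: "finite (contributions n \<Phi> ?u m)" for m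
  proof (cases m rule: expo_cases)
    case (1 e)
    \<comment> \<open>A contribution at \<open>e\<close> writes \<open>e\<close> as a sum over two
      well-ordered sets, which is possible in finitely many ways only; injectivity of
      \<open>?R\<close> on the support leads back to \<open>k\<close>.\<close>
    have "?R ` contributions n \<Phi> ?u m \<subseteq> {a \<in> ?R ` supp \<Phi>. e - a \<in> mcone (gens n)}"
      using contr unfolding 1 by blast
    moreover have "finite {a \<in> ?R ` supp \<Phi>. e - a \<in> mcone (gens n)}"
      by (rule finite_sum_representations[OF wf wfC])
    ultimately have "finite (?R ` contributions n \<Phi> ?u m)" by (rule finite_subset)
    moreover have "inj_on ?R (contributions n \<Phi> ?u m)"
      using inj contr unfolding 1 by (auto intro: inj_on_subset)
    ultimately show ?thesis by (rule finite_imageD)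
  next
    case 2
    then show ?thesis by (simp add: contr_inf)
  qed
  have eval_contr: "contributions n \<Phi> ?u m \<noteq> {}" if "eval_series n \<Phi> ?u m \<noteq> 0" for m
    using that by (auto simp: eval_series_def)
  have supp_eval: "e \<in> (\<lambda>(a, b). a + b) ` (?R ` supp \<Phi> \<times> mcone (gens n))"
    if "eval_series n \<Phi> ?u (ev e) \<noteq> 0" for e
  proof -
    from eval_contr[OF that] obtain k where k: "k \<in> contributions n \<Phi> ?u (ev e)" by auto
    show ?thesis
      by (rule image_eqI[of _ _ "(?R k, e - ?R k)"]) (use contr[OF k] in auto)
  qed
  have "wfp_on {e. eval_series n \<Phi> ?u (ev e) \<noteq> 0} (<)"
    by (rule wfp_on_subset[OF wfp_on_less_image_plus[OF wf wfC]]) (use supp_eval in blast)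
  then have h: "hcoeff (Abs_hahn (\<lambda>e. eval_series n \<Phi> ?u (ev e))) e = eval_series n \<Phi> ?u (ev e)" for e
    by (simp add: Abs_hahn_inverse)
  have "eval_series n \<Phi> ?u = emb (Abs_hahn (\<lambda>e. eval_series n \<Phi> ?u (ev e)))"
    by (rule emb_eqI) (use eval_contr contr_inf in \<open>auto simp: h\<close>)
  moreover have "Abs_hahn (\<lambda>e. eval_series n \<Phi> ?u (ev e)) \<in> hahn_vars n"
  proof -
    have "?R k \<in> expvs n" for k
      unfolding Umonomial_exp_def by (intro expvs_sum expvs_closed Useries_exp_expvs)
    then show ?thesis
      using supp_eval mcone_gens_subset[of n] expvs_closed(2)
      by (fastforce simp: hahn_vars_def hsupp_def h)
  qed
  ultimately have "eval_series n \<Phi> ?u \<in> carrier (ils n)"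
    unfolding carrier_ils by blast
  with fin show ?thesis by (simp add: eval_converges_def)
qed

theorem mainTheorem8:
  fixes n :: nat and r :: int and \<Phi> :: "'a::field_char_0 fseries"
  assumes "n \<ge> 1"
    and "r \<notin> {0..int n - 2}"
    and "r \<noteq> - int ((n - 1) choose 2)"
    and "\<Phi> \<in> series_set n (rho n (useries n r :: nat \<Rightarrow> 'a fseries))"
  shows "eval_converges n \<Phi> (useries n r) \<and>
         const_term (eval_series n \<Phi> (useries n r)) = const_term \<Phi>"
proof
  show "eval_converges n \<Phi> (useries n r)"
    by (rule eval_converges_useries[OF assms(4)])
  let ?u = "useries n r :: nat \<Rightarrow> 'a fseries" and ?o = "\<lambda>_ :: nat. 0 :: int"
  have mon: "monomial_at n ?u k ?o = hcoeff (Umonomial n r k) 0" for k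
    using emb_ev[of _ 0] by (simp add: monomial_at_eq_emb zero_expv.rep_eq)
  \<comment> \<open>\<open>monomial_at\<close> sees only the entries of \<open>k\<close> at 1, ...,
    n, so vectors that are nonzero elsewhere are excluded by the support of \<Phi>.\<close>
  have "\<Phi> k = 0" if "k \<notin> expos n" for k
    using assms(4) that by (auto simp: series_set_def supp_def)
  moreover have "monomial_at n ?u k ?o = 0" if "k \<in> expos n" "k \<noteq> ?o" for k
  proof -
    obtain j where "k j \<noteq> 0" using \<open>k \<noteq> ?o\<close> by auto
    moreover from this have "j \<in> {1..n}" using \<open>k \<in> expos n\<close> by (auto simp: expos_def)
    ultimately show ?thesis unfolding mon using const_term_Umonomial[OF assms(1-3)] by blast
  qed
  ultimately have "contributions n \<Phi> ?u ?o \<subseteq> {?o}"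
    by (fastforce simp: contributions_def)
  then have "eval_series n \<Phi> ?u ?o = (\<Sum>k\<in>{?o}. \<Phi> k * monomial_at n ?u k ?o)"
    unfolding eval_series_def by (intro sum.mono_neutral_left) (auto simp: contributions_def)
  also have "\<dots> = \<Phi> ?o"
    by (simp add: mon Umonomial_def zpow_def hcoeff_1)
  finally show "const_term (eval_series n \<Phi> ?u) = const_term \<Phi>"
    by (simp add: const_term_def)
qed

end
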